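(* Let $0<\alpha<1$. The state probabilities of the time-changed Erlang queue with multiple arrivals $\{\mathcal{Q}^\alpha(t)\}_{t\ge 0}$ solve the following system of difference-differential equations ($t>0$): $$\begin{aligned} \frac{\mathrm d^\alpha}{\mathrm dt^\alpha}p^\alpha_{0}(t)&=-\lambda p^\alpha_{0}(t)+k\mu p^\alpha_{1,1}(t),\\ \frac{\mathrm d^\alpha}{\mathrm dt^\alpha}p^\alpha_{1,s}(t)&=-(\lambda+k\mu)p^\alpha_{1,s}(t)+k\mu p^\alpha_{1,s+1}(t),\quad 1\le s\le k-1,\\ \frac{\mathrm d^\alpha}{\mathrm dt^\alpha}p^\alpha_{1,k}(t)&=-(\lambda+k\mu)p^\alpha_{1,k}(t)+k\mu p^\alpha_{2,1}(t)+\lambda c_1p^\alpha_0(t),\\ \frac{\mathrm d^\alpha}{\mathrm dt^\alpha}p^\alpha_{n,s}(t)&=-(\lambda+k\mu)p^\alpha_{n,s}(t)+k\mu p^\alpha_{n,s+1}(t)+\lambda\sum_{m=1}^{\min\{n,l\}}c_mp^\alpha_{n-m,s}(t),\quad 1\le s\le k-1,\ n\ge 2,\\ \frac{\mathrm d^\alpha}{\mathrm dt^\alpha}p^\alpha_{n,k}(t)&=-(\lambda+k\mu)p^\alpha_{n,k}(t)+k\mu p^\alpha_{n+1,1}(t)+\lambda\sum_{m=1}^{n-1}c_mp^\alpha_{n-m,k}(t)+\lambda c_np^\alpha_0(t),\quad 2\le n\le l,\\ \frac{\mathrm d^\alpha}{\mathrm dt^\alpha}p^\alpha_{n,k}(t)&=-(\lambda+k\mu)p^\alpha_{n,k}(t)+k\mu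 p^\alpha_{n+1,1}(t)+\lambda\sum_{m=1}^{l}c_mp^\alpha_{n-m,k}(t),\quad n>l, \end{aligned}$$ with $p^\alpha_0(0)=1$ and $p^\alpha_{n,s}(0)=0$ for $1\le s\le k$, $n\ge 1$, where $\frac{\mathrm d^\alpha}{\mathrm dt^\alpha}$ is the Caputo fractional derivative.
   Context: Let $k,l\ge 1$ be integers, $\mu>0$, $\lambda_1,\dots,\lambda_l>0$, $\lambda=\lambda_1+\dots+\lambda_l$ and $c_m=\lambda_m/\lambda$ for $1\le m\le l$. The Erlang queue with multiple arrivals is the continuous-time Markov process $\mathcal{Q}(t)=(\mathcal{N}(t),\mathcal{S}(t))$, $t\ge 0$, on the state space $\mathcal{H}_0=\mathcal{H}\cup\{(0,0)\}$, $\mathcal{H}=\{(n,s)\in\mathbb{N}\times\mathbb{N}: n\ge 1,\ 1\le s\le k\}$, with $\mathcal{Q}(0)=(0,0)$. Here $\mathcal{N}(t)$ is the number of customers in a single-channel system and $\mathcal{S}(t)$ is the phase of the customer in service (each service starts in phase $k$, and the phases are counted down to $1$), with $\mathcal{S}(t)=0$ if $\mathcal{N}(t)=0$. Its nonzero transition rates (an event of rate $q$ has probability $qh+o(h)$ in an interval of length $h$) are, for $1\le m\le l$: (arrivals) $(0,0)\to(m,k)$ at rate $\lambda_m=\lambda c_m$, and $(n,s)\to(n+m,s)$ at rate $\lambda_m=\lambda c_m$ for $(n,s)\in\mathcal{H}$; (service, each phase being exponential with mean $1/(k\mu)$) at rate $k\mu$: $(n,s)\to(n,s-1)$ for $n\ge1$,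 $2\le s\le k$; $(n,1)\to(n-1,k)$ for $n\ge 2$; and $(1,1)\to(0,0)$. For $0<\alpha<1$ let $\{D_\alpha(t)\}_{t\ge0}$ be an $\alpha$-stable subordinator, i.e. the one-dimensional non-decreasing Lévy process with $\mathbb{E}(e^{-zD_\alpha(t)})=e^{-tz^\alpha}$, $z>0$, and let $Y_\alpha(t)=\inf\{s\ge 0: D_\alpha(s)>t\}$ be its first hitting time (inverse $\alpha$-stable subordinator), taken independent of $\mathcal{Q}$. The time-changed Erlang queue with multiple arrivals is $\mathcal{Q}^\alpha(t)=\mathcal{Q}(Y_\alpha(t))$, $t\ge0$, with state probabilities $p^\alpha_0(t)=\Pr(\mathcal{Q}^\alpha(t)=(0,0)\mid\mathcal{Q}^\alpha(0)=(0,0))$ and $p^\alpha_{n,s}(t)=\Pr(\mathcal{Q}^\alpha(t)=(n,s)\mid\mathcal{Q}^\alpha(0)=(0,0))$ for $(n,s)\in\mathcal{H}$. By convention $p^\alpha_{0,s}(t)=0$ for $1\le s\le k$. The Caputo fractional derivative of order $\alpha\in(0,1)$ is $\frac{\mathrm d^\alpha}{\mathrm dt^\alpha}f(t)=\frac{1}{\Gamma(1-\alpha)}\int_0^t(t-y)^{-\alpha}f'(y)\,\mathrm dy$; its Laplace transform at $z$ is $z^\alpha\tilde f(z)-z^{\alpha-1}f(0)$, where $\tilde f$ is the Laplace transform of $f$. *)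

theory Defs
  imports "HOL-Probability.Probability"
begin

text \<open>
  A time-homogeneous pure jump Markov process on the countable state space \<open>S\<close> with transition
  rates \<open>q x y\<close> for \<open>x \<noteq> y\<close>.  The conditions on conditional probabilities are imposed only where
  the conditioning event has positive probability.  The last condition is conservativity: the
  probability of leaving \<open>x\<close> within time \<open>h\<close> is the total rate out of \<open>x\<close> times \<open>h\<close>, up to \<open>o(h)\<close>.
\<close>

definition markov_jump_process ::
    "'w measure \<Rightarrow> 's set \<Rightarrow> ('s \<Rightarrow> 's \<Rightarrow> real) \<Rightarrow> (real \<Rightarrow> 'w \<Rightarrow> 's) \<Rightarrow> bool" where
  "markov_jump_process M S q X \<longleftrightarrow>
     (\<forall>t\<ge>0. X t \<in> M \<rightarrow>\<^sub>M count_space S) \<and>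
     (\<forall>\<omega>\<in>space M. \<forall>t\<ge>0. \<forall>\<^sub>F u in at_right t. X u \<omega> = X t \<omega>) \<and>
     (\<forall>T \<xi> t h x y. finite T \<longrightarrow> T \<subseteq> {0..<t} \<longrightarrow> 0 \<le> t \<longrightarrow> 0 \<le> h \<longrightarrow>
        0 < \<P>(\<omega> in M. X t \<omega> = x \<and> (\<forall>u\<in>T. X u \<omega> = \<xi> u)) \<longrightarrow>
        \<P>(\<omega> in M. X (t + h) \<omega> = y \<bar> X t \<omega> = x \<and> (\<forall>u\<in>T. X u \<omega> = \<xi> u)) =
        \<P>(\<omega> in M. X (t + h) \<omega> = y \<bar> X t \<omega> = x)) \<and>
     (\<forall>t u h x y. 0 \<le> t \<longrightarrow> 0 \<le> u \<longrightarrow> 0 \<le> h \<longrightarrow>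
        0 < \<P>(\<omega> in M. X t \<omega> = x) \<longrightarrow> 0 < \<P>(\<omega> in M. X u \<omega> = x) \<longrightarrow>
        \<P>(\<omega> in M. X (t + h) \<omega> = y \<bar> X t \<omega> = x) = \<P>(\<omega> in M. X (u + h) \<omega> = y \<bar> X u \<omega> = x)) \<and>
     (\<forall>t x y. 0 \<le> t \<longrightarrow> x \<in> S \<longrightarrow> y \<in> S \<longrightarrow> x \<noteq> y \<longrightarrow> 0 < \<P>(\<omega> in M. X t \<omega> = x) \<longrightarrow>
        ((\<lambda>h. \<P>(\<omega> in M. X (t + h) \<omega> = y \<bar> X t \<omega> = x) / h) \<longlongrightarrow> q x y) (at_right 0)) \<and>
     (\<forall>t x. 0 \<le> t \<longrightarrow> x \<in> S \<longrightarrow> 0 < \<P>(\<omega> in M. X t \<omega> = x) \<longrightarrow>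
        ((\<lambda>h. \<P>(\<omega> in M. X (t + h) \<omega> \<noteq> x \<bar> X t \<omega> = x) / h)
           \<longlongrightarrow> (\<Sum>\<^sub>\<infinity>y\<in>S - {x}. q x y)) (at_right 0))"

definition erlang_busy_states :: "nat \<Rightarrow> (nat \<times> nat) set" where
  "erlang_busy_states k = {(n, s). 1 \<le> n \<and> 1 \<le> s \<and> s \<le> k}"

definition erlang_states :: "nat \<Rightarrow> (nat \<times> nat) set" where
  "erlang_states k = insert (0, 0) (erlang_busy_states k)"

definition erlang_arrival :: "nat \<Rightarrow> nat \<Rightarrow> nat \<times> nat \<Rightarrow> nat \<times> nat \<Rightarrow> bool" where
  "erlang_arrival k m x y \<longleftrightarrow>
     x = (0, 0) \<and> y = (m, k) \<or>
     (\<exists>n s. (n, s) \<in> erlang_busy_states k \<and> x = (n, s) \<and> y = (n + m, s))"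

definition erlang_service :: "nat \<Rightarrow> nat \<times> nat \<Rightarrow> nat \<times> nat \<Rightarrow> bool" where
  "erlang_service k x y \<longleftrightarrow>
     (\<exists>n s. 1 \<le> n \<and> 2 \<le> s \<and> s \<le> k \<and> x = (n, s) \<and> y = (n, s - 1)) \<or>
     (\<exists>n\<ge>2. x = (n, 1) \<and> y = (n - 1, k)) \<or>
     x = (1, 1) \<and> y = (0, 0)"

text \<open>For given \<open>x\<close> and \<open>y\<close> at most one of the summands below is nonzero.\<close>

definition erlang_rate ::
    "nat \<Rightarrow> nat \<Rightarrow> real \<Rightarrow> (nat \<Rightarrow> real) \<Rightarrow> nat \<times> nat \<Rightarrow> nat \<times> nat \<Rightarrow> real" where
  "erlang_rate k l \<mu> lam x y =
     (\<Sum>m = 1..l. if erlang_arrival k m x y then lam m else 0) +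
     (if erlang_service k x y then real k * \<mu> else 0)"

definition erlang_queue ::
    "'w measure \<Rightarrow> nat \<Rightarrow> nat \<Rightarrow> real \<Rightarrow> (nat \<Rightarrow> real) \<Rightarrow> (real \<Rightarrow> 'w \<Rightarrow> nat \<times> nat) \<Rightarrow> bool" where
  "erlang_queue M k l \<mu> lam Q \<longleftrightarrow>
     markov_jump_process M (erlang_states k) (erlang_rate k l \<mu> lam) Q \<and>
     (AE \<omega> in M. Q 0 \<omega> = (0, 0))"

definition levy_process :: "'w measure \<Rightarrow> (real \<Rightarrow> 'w \<Rightarrow> real) \<Rightarrow> bool" where
  "levy_process M D \<longleftrightarrow>
     (\<forall>t\<ge>0. D t \<in> borel_measurable M) \<and>
     (AE \<omega> in M. D 0 \<omega> = 0) \<and>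
     (\<forall>\<omega>\<in>space M. (\<forall>t\<ge>0. ((\<lambda>u. D u \<omega>) \<longlongrightarrow> D t \<omega>) (at_right t)) \<and>
                   (\<forall>t>0. \<exists>L. ((\<lambda>u. D u \<omega>) \<longlongrightarrow> L) (at_left t))) \<and>
     (\<forall>n (\<tau> :: nat \<Rightarrow> real). 0 \<le> \<tau> 0 \<longrightarrow> (\<forall>i<n. \<tau> i \<le> \<tau> (Suc i)) \<longrightarrow>
        prob_space.indep_vars M (\<lambda>_. borel) (\<lambda>i \<omega>. D (\<tau> (Suc i)) \<omega> - D (\<tau> i) \<omega>) {..<n}) \<and>
     (\<forall>u\<ge>0. \<forall>h\<ge>0. distr M borel (\<lambda>\<omega>. D (u + h) \<omega> - D u \<omega>) = distr M borel (D h))"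

definition stable_subordinator :: "'w measure \<Rightarrow> real \<Rightarrow> (real \<Rightarrow> 'w \<Rightarrow> real) \<Rightarrow> bool" where
  "stable_subordinator M \<alpha> D \<longleftrightarrow>
     levy_process M D \<and>
     (\<forall>\<omega>\<in>space M. mono_on {0..} (\<lambda>t. D t \<omega>)) \<and>
     (\<forall>t\<ge>0. \<forall>z>0. (\<integral>\<omega>. exp (- z * D t \<omega>) \<partial>M) = exp (- t * z powr \<alpha>))"

text \<open>
  For a stable subordinator the set below is almost surely nonempty; the value \<open>0\<close> on the
  exceptional null set (where the real-valued infimum would be unspecified) is immaterial.
\<close>

definition first_hitting_time :: "(real \<Rightarrow> 'w \<Rightarrow> real) \<Rightarrow> real \<Rightarrow> 'w \<Rightarrow> real" where
  "first_hitting_time D t \<omega> =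
     (if \<exists>s\<ge>0. D s \<omega> > t then Inf {s. 0 \<le> s \<and> D s \<omega> > t} else 0)"

text \<open>
  Independence of two whole processes, i.e. of the sigma-algebras generated by the families
  \<open>(X t)\<close> and \<open>(Y t)\<close>, \<open>t \<ge> 0\<close>.  (The library's \<open>indep_var\<close> needs equal value types.)
\<close>

definition indep_processes ::
    "'w measure \<Rightarrow> 'a measure \<Rightarrow> (real \<Rightarrow> 'w \<Rightarrow> 'a) \<Rightarrow> 'b measure \<Rightarrow> (real \<Rightarrow> 'w \<Rightarrow> 'b) \<Rightarrow> bool" where
  "indep_processes M A X B Y \<longleftrightarrow>
     prob_space.indep_set M
       (sets (vimage_algebra (space M) (\<lambda>\<omega>. \<lambda>t\<in>{0..}. X t \<omega>) (\<Pi>\<^sub>M t\<in>{0..}. A)))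
       (sets (vimage_algebra (space M) (\<lambda>\<omega>. \<lambda>t\<in>{0..}. Y t \<omega>) (\<Pi>\<^sub>M t\<in>{0..}. B)))"

definition time_changed :: "(real \<Rightarrow> 'w \<Rightarrow> 'a) \<Rightarrow> (real \<Rightarrow> 'w \<Rightarrow> real) \<Rightarrow> real \<Rightarrow> 'w \<Rightarrow> 'a" where
  "time_changed X Y t \<omega> = X (Y t \<omega>) \<omega>"

text \<open>
  \<open>has_caputo_derivative \<alpha> f d t\<close>: the Caputo derivative of order \<open>\<alpha>\<close> of \<open>f\<close> at \<open>t\<close> exists and is
  \<open>d\<close>.  The integrand is required to exist and to be Lebesgue integrable.  Continuity on the closed
  interval excludes a jump at \<open>0\<close>, which the integral could not see and for which the rule
  \<open>z powr \<alpha> * F z - z powr (\<alpha> - 1) * f 0\<close> for the Laplace transform would fail.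
\<close>

definition has_caputo_derivative :: "real \<Rightarrow> (real \<Rightarrow> real) \<Rightarrow> real \<Rightarrow> real \<Rightarrow> bool" where
  "has_caputo_derivative \<alpha> f d t \<longleftrightarrow>
     continuous_on {0..t} f \<and>
     (\<forall>y\<in>{0<..<t}. f differentiable (at y)) \<and>
     set_integrable lborel {0<..<t} (\<lambda>y. (t - y) powr (- \<alpha>) * deriv f y) \<and>
     d = 1 / Gamma (1 - \<alpha>) * (LINT y:{0<..<t}|lborel. (t - y) powr (- \<alpha>) * deriv f y)"

end

theory Submission
  imports Defs "HOL-Real_Asymp.Real_Asymp"
begin

text \<open>
  Write \<open>P x s\<close> for the probability that the queue is in state \<open>x\<close> at time \<open>s\<close>.  The total rates out of
  the states are bounded, so these functions satisfy Kolmogorov's forward equations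
  \<open>(P y)' = (\<Sum>x. q x y * P x) - q y * P y\<close>, where \<open>q y\<close> is the total rate out of \<open>y\<close>
  (\<open>forward_equation\<close>).  The inverse subordinator is independent of the queue, hence the state
  probabilities of the time-changed queue are \<open>E (P x (Y t))\<close> (\<open>law_random_time\<close>).  It remains to see
  that passing from \<open>F\<close> to \<open>t \<mapsto> E (F (Y t))\<close> turns the ordinary derivative into the Caputo derivative.

  By self-similarity \<open>D s\<close> is distributed as \<open>s powr (1/\<alpha>) * D 1\<close>, and so \<open>Y t\<close> is distributed as
  \<open>t powr \<alpha> * W\<close> with \<open>W = D 1 powr - \<alpha>\<close> (\<open>distr_first_hitting_time\<close>).  This gives smoothness in \<open>t\<close>
  without any knowledge of a density: the function \<open>f t = E (F (t powr \<alpha> * W))\<close> can be differentiated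
  under the expectation, with
  \<open>f' y = \<alpha> * y powr (\<alpha> - 1) * E (W * F' (y powr \<alpha> * W))\<close>.  The Caputo derivative of \<open>f\<close> at \<open>t\<close> is
  therefore the integral of \<open>F'\<close> with respect to an explicit measure on the half-line, the image of
  \<open>(t - y) powr - \<alpha> / Gamma (1 - \<alpha>) * \<alpha> * y powr (\<alpha> - 1) * W dy dP\<close> under \<open>(y, \<omega>) \<mapsto> y powr \<alpha> * W \<omega>\<close>.
  That measure is the law of \<open>t powr \<alpha> * W\<close> (\<open>mittag_leffler_size_bias\<close>): since
  \<open>E (W ^ n) = n! / Gamma (1 + n * \<alpha>)\<close>, a Beta integral shows that both have the same moments, and these
  grow slowly enough to determine the distribution (\<open>real_distribution_eqI_moments\<close>).  Hence the Caputo
  derivative of \<open>f\<close> is \<open>E (F' (Y t))\<close>, which for \<open>F = P y\<close> is the right-hand side of the forward equation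
  for the time-changed probabilities (\<open>fractional_forward_equation\<close>).
\<close>

section \<open>Distributions determined by their moments\<close>

text \<open>
  The growth condition makes \<open>\<theta> \<mapsto> E (exp (\<theta> * X))\<close> finite everywhere, so the characteristic function
  may be expanded termwise into a power series whose coefficients are given by the moments.  The
  distributions below (bounded ones and those of Mittag-Leffler type) meet it.
\<close>

lemma real_distribution_eqI_moments:
  fixes N N' :: "real measure" and m :: "nat \<Rightarrow> real"
  assumes N: "real_distribution N" and N': "real_distribution N'"
    and pos: "AE x in N. 0 \<le> x" and pos': "AE x in N'. 0 \<le> x"
    and mom: "\<And>n. has_bochner_integral N (\<lambda>x. x ^ n) (m n)"
    and mom': "\<And>n. has_bochner_integral N' (\<lambda>x. x ^ n) (m n)"
    and summ: "\<And>\<theta>. 0 < \<theta> \<Longrightarrow> summable (\<lambda>n. \<theta> ^ n * m n / fact n)"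
  shows "N = N'"
proof -
  have char_series: "char K t = (\<Sum>n. (\<i> * of_real t) ^ n /\<^sub>R fact n * of_real (m n))"
    if K: "real_distribution K" and posK: "AE x in K. 0 \<le> x"
      and momK: "\<And>n. has_bochner_integral K (\<lambda>x. x ^ n) (m n)" for K t
  proof -
    interpret K: real_distribution K by fact
    define g where "g n x = (\<i> * of_real t) ^ n /\<^sub>R fact n * complex_of_real (x ^ n)" for n x
    have exp_series: "iexp (t * x) = (\<Sum>n. g n x)" for x
      by (simp add: exp_def g_def power_mult_distrib mult_ac scaleR_conv_of_real divide_simps)
    have norm_g: "norm (g n x) = \<bar>t\<bar> ^ n / fact n * \<bar>x\<bar> ^ n" for n x
      by (simp add: g_def norm_mult norm_power divide_simps)
    have int_pow: "integrable K (\<lambda>x. x ^ n)" and val: "(\<integral>x. x ^ n \<partial>K) = m n" for n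
      using momK[of n] by (auto simp: has_bochner_integral_iff)
    have int_g: "integrable K (g n)" for n
      unfolding g_def by (intro integrable_mult_right integrable_of_real int_pow)
    have "(\<integral>x. \<bar>x\<bar> ^ n \<partial>K) = m n" for n
      unfolding val[symmetric] by (intro integral_cong_AE) (use posK in auto)
    hence norm_int: "(\<integral>x. norm (g n x) \<partial>K) = \<bar>t\<bar> ^ n * m n / fact n" for n
      unfolding norm_g by simp
    have "char K t = (\<integral>x. (\<Sum>n. g n x) \<partial>K)"
      unfolding char_def exp_series by simp
    also have "\<dots> = (\<Sum>n. \<integral>x. g n x \<partial>K)"
    proof (rule integral_suminf[OF int_g])
      show "AE x in K. summable (\<lambda>n. norm (g n x))"
      proof (rule AE_I2)
        fix x show "summable (\<lambda>n. norm (g n x))"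
          using summable_exp[of "\<bar>t\<bar> * \<bar>x\<bar>"]
          by (simp add: norm_g power_mult_distrib divide_simps mult_ac)
      qed
      show "summable (\<lambda>n. \<integral>x. norm (g n x) \<partial>K)"
      proof (cases "t = 0")
        case True
        have "summable (\<lambda>n. 0 ^ n * m n / fact n)"
          by (rule summable_finite[of "{0}"]) (auto simp: power_0_left)
        thus ?thesis unfolding norm_int True by simp
      next
        case False
        thus ?thesis unfolding norm_int by (intro summ) simp
      qed
    qed
    also have "(\<lambda>n. \<integral>x. g n x \<partial>K) = (\<lambda>n. (\<i> * of_real t) ^ n /\<^sub>R fact n * of_real (m n))"
      unfolding g_def by (intro ext) (simp only: integral_mult_right_zero integral_complex_of_real val)
    finally show ?thesis .
  qed
  show ?thesis
    by (rule Levy_uniqueness[OF N N']) (auto simp: fun_eq_iff char_series[OF N pos mom] char_series[OF N' pos' mom'])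
qed

section \<open>The inverse stable subordinator\<close>

text \<open>
  Markov's inequality for \<open>exp (- z * X)\<close>.  Letting \<open>z\<close> tend to infinity at \<open>t = 0\<close> shows that the
  subordinator is positive at positive times; time tending to infinity shows that it is unbounded.
\<close>

lemma (in prob_space) lower_tail_le_laplace:
  assumes [measurable]: "X \<in> borel_measurable M"
    and "integrable M (\<lambda>\<omega>. exp (- z * X \<omega>))" and "0 \<le> z"
  shows "\<P>(\<omega> in M. X \<omega> \<le> t) \<le> exp (z * t) * (\<integral>\<omega>. exp (- z * X \<omega>) \<partial>M)"
proof -
  have "\<P>(\<omega> in M. X \<omega> \<le> t) = \<P>(\<omega> in M. 1 \<le> exp (z * t) * exp (- z * X \<omega>))" if "0 < z"
  proof -
    have "X \<omega> \<le> t \<longleftrightarrow> 1 \<le> exp (z * t) * exp (- z * X \<omega>)" for \<omega>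
      using that by (simp add: exp_add[symmetric] mult_le_cancel_left_pos)
    thus ?thesis by simp
  qed
  moreover have "\<P>(\<omega> in M. 1 \<le> exp (z * t) * exp (- z * X \<omega>)) \<le> (\<integral>\<omega>. exp (z * t) * exp (- z * X \<omega>) \<partial>M) / 1"
    by (rule integral_Markov_inequality_measure[where A = "{}"]) (use assms in auto)
  ultimately show ?thesis
    using assms by (cases "z = 0") (auto simp: prob_space)
qed

context
  fixes M :: "'w measure" and \<alpha> :: real and D :: "real \<Rightarrow> 'w \<Rightarrow> real"
  assumes M: "prob_space M" and \<alpha>: "0 < \<alpha>" and D: "stable_subordinator M \<alpha> D"
begin

interpretation prob_space M by (rule M)

lemma subordinator_measurable: "0 \<le> s \<Longrightarrow> D s \<in> borel_measurable M"
  using D by (auto simp: stable_subordinator_def levy_process_def)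

text \<open>
  Integrability is implicit in the value: the integral of a non-integrable function would be \<open>0\<close>.
\<close>

lemma subordinator_laplace:
  assumes "0 \<le> s" "0 < z"
  shows "has_bochner_integral M (\<lambda>\<omega>. exp (- z * D s \<omega>)) (exp (- s * z powr \<alpha>))"
proof -
  have eq: "(\<integral>\<omega>. exp (- z * D s \<omega>) \<partial>M) = exp (- s * z powr \<alpha>)"
    using D assms by (auto simp: stable_subordinator_def)
  hence "integrable M (\<lambda>\<omega>. exp (- z * D s \<omega>))"
    by (metis exp_not_eq_zero not_integrable_integral_eq)
  with eq show ?thesis by (simp add: has_bochner_integral_iff)
qed

lemma subordinator_prob_le:
  assumes "0 \<le> s" "0 < z"
  shows "\<P>(\<omega> in M. D s \<omega> \<le> t) \<le> exp (z * t - s * z powr \<alpha>)"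
  using lower_tail_le_laplace[OF subordinator_measurable, of s z t] subordinator_laplace[OF assms] assms
  by (simp add: has_bochner_integral_iff exp_diff exp_minus divide_inverse)

lemma subordinator_pos:
  assumes "0 < s"
  shows "AE \<omega> in M. 0 < D s \<omega>"
proof -
  have [measurable]: "D s \<in> borel_measurable M" using assms by (intro subordinator_measurable) simp
  have "\<P>(\<omega> in M. D s \<omega> \<le> 0) \<le> 0"
  proof (rule tendsto_lowerbound[where F = at_top])
    have "filterlim (\<lambda>z. s * z powr \<alpha>) at_top at_top"
      using assms \<alpha> by real_asymp
    thus "((\<lambda>z. exp (- (s * z powr \<alpha>))) \<longlongrightarrow> 0) at_top"
      by (intro filterlim_compose[OF exp_at_bot] filterlim_compose[OF filterlim_uminus_at_bot_at_top])
    show "\<forall>\<^sub>F z in at_top. \<P>(\<omega> in M. D s \<omega> \<le> 0) \<le> exp (- (s * z powr \<alpha>))"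
      using eventually_gt_at_top[of 0] by eventually_elim (use subordinator_prob_le[of s _ 0] assms in auto)
  qed auto
  hence "\<P>(\<omega> in M. D s \<omega> \<le> 0) = 0" using measure_nonneg[of M] by (simp add: antisym)
  hence "AE \<omega> in M. \<not> D s \<omega> \<le> 0"
    by (intro AE_I'[of "{\<omega> \<in> space M. D s \<omega> \<le> 0}"]) (auto simp: null_sets_def emeasure_eq_measure)
  thus ?thesis by eventually_elim simp
qed

lemma subordinator_unbounded: "AE \<omega> in M. \<exists>s\<ge>0. t < D s \<omega>"
proof -
  have "AE \<omega> in M. \<exists>n. t < D (real n) \<omega>"
  proof -
    have meas[measurable]: "D (real n) \<in> borel_measurable M" for n by (intro subordinator_measurable) simp
    have "\<P>(\<omega> in M. \<forall>n. D (real n) \<omega> \<le> t) \<le> 0"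
    proof (rule tendsto_lowerbound[where F = sequentially])
      show "(\<lambda>n. exp (t - real n)) \<longlonglongrightarrow> 0" by real_asymp
      show "\<forall>\<^sub>F n in sequentially. \<P>(\<omega> in M. \<forall>n. D (real n) \<omega> \<le> t) \<le> exp (t - real n)"
      proof (rule always_eventually, rule allI)
        fix n
        have "\<P>(\<omega> in M. \<forall>n. D (real n) \<omega> \<le> t) \<le> \<P>(\<omega> in M. D (real n) \<omega> \<le> t)"
          by (intro finite_measure_mono) auto
        also have "\<dots> \<le> exp (t - real n)" using subordinator_prob_le[of "real n" 1 t] by simp
        finally show "\<P>(\<omega> in M. \<forall>n. D (real n) \<omega> \<le> t) \<le> exp (t - real n)" .
      qed
    qed auto
    hence "\<P>(\<omega> in M. \<forall>n. D (real n) \<omega> \<le> t) = 0" using measure_nonneg[of M] by (simp add: antisym)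
    hence "AE \<omega> in M. \<not> (\<forall>n. D (real n) \<omega> \<le> t)"
      by (intro AE_I'[of "{\<omega> \<in> space M. \<forall>n. D (real n) \<omega> \<le> t}"]) (auto simp: null_sets_def emeasure_eq_measure)
    thus ?thesis by eventually_elim (auto simp: not_le)
  qed
  thus ?thesis by eventually_elim (metis of_nat_0_le_iff)
qed

text \<open>
  The laws are compared after the bounded injective transformation \<open>x \<mapsto> exp (- x)\<close>: its \<open>n\<close>-th moment
  is the Laplace transform at \<open>n\<close>, and on both sides this is \<open>exp (- s * n powr \<alpha>)\<close>.
\<close>

lemma subordinator_self_similar:
  assumes "0 \<le> s"
  shows "distr M borel (\<lambda>\<omega>. exp (- D s \<omega>)) = distr M borel (\<lambda>\<omega>. exp (- (s powr (1/\<alpha>) * D 1 \<omega>)))"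
proof -
  have [measurable]: "D s \<in> borel_measurable M" "D 1 \<in> borel_measurable M"
    using assms by (auto intro!: subordinator_measurable)
  define m where "m n = (if n = 0 then 1 else exp (- s * real n powr \<alpha>))" for n :: nat
  have mom1: "has_bochner_integral M (\<lambda>\<omega>. exp (- D s \<omega>) ^ n) (m n)" for n
    using subordinator_laplace[OF assms, of "real n"]
    by (cases "n = 0") (auto simp: m_def exp_of_nat_mult[symmetric] has_bochner_integral_iff prob_space)
  have mom2: "has_bochner_integral M (\<lambda>\<omega>. exp (- (s powr (1/\<alpha>) * D 1 \<omega>)) ^ n) (m n)" for n
  proof (cases "n = 0 \<or> s = 0")
    case True
    thus ?thesis by (auto simp: m_def has_bochner_integral_iff prob_space)
  next
    case False
    hence "(real n * s powr (1/\<alpha>)) powr \<alpha> = s * real n powr \<alpha>"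
      using assms \<alpha> by (simp add: powr_mult powr_powr)
    thus ?thesis using subordinator_laplace[of 1 "real n * s powr (1/\<alpha>)"] False assms
      by (auto simp: m_def exp_of_nat_mult[symmetric] mult.assoc)
  qed
  show ?thesis
  proof (rule real_distribution_eqI_moments[where m = m])
    show "has_bochner_integral (distr M borel (\<lambda>\<omega>. exp (- D s \<omega>))) (\<lambda>x. x ^ n) (m n)" for n
      using mom1[of n] by (simp add: has_bochner_integral_iff integrable_distr_eq integral_distr)
    show "has_bochner_integral (distr M borel (\<lambda>\<omega>. exp (- (s powr (1/\<alpha>) * D 1 \<omega>)))) (\<lambda>x. x ^ n) (m n)" for n
      using mom2[of n] by (simp add: has_bochner_integral_iff integrable_distr_eq integral_distr)
    show "summable (\<lambda>n. \<theta> ^ n * m n / fact n)" if "0 < \<theta>" for \<theta>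
    proof (rule summable_comparison_test'[OF summable_exp[of \<theta>], of 0])
      fix n
      have "0 \<le> m n" "m n \<le> 1" using assms by (auto simp: m_def)
      thus "norm (\<theta> ^ n * m n / fact n) \<le> inverse (fact n) * \<theta> ^ n"
        using that by (auto simp: divide_simps intro!: mult_left_le)
    qed
  qed (auto simp: AE_distr_iff)
qed

text \<open>
  Self-similarity written as a statement on \<open>D 1 powr - \<alpha>\<close>; by monotonicity of the paths the left-hand
  side is, up to the boundary case, the distribution function of the first hitting time of \<open>t\<close>.
\<close>

lemma subordinator_prob_gt:
  assumes s: "0 \<le> s" and t: "0 \<le> t"
  shows "\<P>(\<omega> in M. t < D s \<omega>) = \<P>(\<omega> in M. t powr \<alpha> * D 1 \<omega> powr - \<alpha> < s)"
proof -
  have [measurable]: "D s \<in> borel_measurable M" "D 1 \<in> borel_measurable M"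
    using assms by (auto intro!: subordinator_measurable)
  have "\<P>(\<omega> in M. t < D s \<omega>) = measure (distr M borel (\<lambda>\<omega>. exp (- D s \<omega>))) {..<exp (-t)}"
    by (subst measure_distr) (auto intro!: arg_cong[where f = "measure M"])
  also have "\<dots> = \<P>(\<omega> in M. t < s powr (1/\<alpha>) * D 1 \<omega>)"
    unfolding subordinator_self_similar[OF s]
    by (subst measure_distr) (auto intro!: arg_cong[where f = "measure M"])
  also have "\<dots> = \<P>(\<omega> in M. t powr \<alpha> * D 1 \<omega> powr - \<alpha> < s)"
  proof (rule prob_eq_AE)
    show "AE \<omega> in M. t < s powr (1/\<alpha>) * D 1 \<omega> \<longleftrightarrow> t powr \<alpha> * D 1 \<omega> powr - \<alpha> < s"
      using subordinator_pos[of 1, simplified]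
    proof eventually_elim
      case (elim \<omega>)
      have "t < s powr (1/\<alpha>) * D 1 \<omega> \<longleftrightarrow> t powr \<alpha> < (s powr (1/\<alpha>) * D 1 \<omega>) powr \<alpha>"
        using elim t s \<alpha> by (meson less_imp_le mult_nonneg_nonneg not_le powr_ge_zero powr_less_mono2 powr_mono2)
      also have "(s powr (1/\<alpha>) * D 1 \<omega>) powr \<alpha> = s * D 1 \<omega> powr \<alpha>"
        using s elim \<alpha> by (simp add: powr_mult powr_powr)
      finally show ?case using elim by (simp add: powr_minus field_simps)
    qed
  qed auto
  finally show ?thesis .
qed

lemma first_hitting_time_nonneg: "0 \<le> first_hitting_time D t \<omega>"
  unfolding first_hitting_time_def by (auto intro!: cInf_greatest)

text \<open>
  Monotone paths give \<open>{Y t < s} \<subseteq> {t < D s} \<subseteq> {Y t \<le> s}\<close> up to a null set.  By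
  \<open>subordinator_prob_gt\<close> the event in the middle has the probability that \<open>t powr \<alpha> * D 1 powr - \<alpha> < s\<close>,
  so the two distribution functions are interlaced, and being right-continuous they agree.
\<close>

lemma distr_first_hitting_time:
  assumes t: "0 \<le> t" and [measurable]: "first_hitting_time D t \<in> borel_measurable M"
  shows "distr M borel (first_hitting_time D t) = distr M borel (\<lambda>\<omega>. t powr \<alpha> * D 1 \<omega> powr - \<alpha>)"
proof -
  have [measurable]: "D s \<in> borel_measurable M" if "0 \<le> s" for s
    using that by (auto intro!: subordinator_measurable)
  have [measurable]: "D 1 \<in> borel_measurable M" by (auto intro!: subordinator_measurable)
  let ?Y = "first_hitting_time D t" and ?V = "\<lambda>\<omega>. t powr \<alpha> * D 1 \<omega> powr - \<alpha>"
  have mono: "mono_on {0..} (\<lambda>t. D t \<omega>)" if "\<omega> \<in> space M" for \<omega>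
    using D that by (auto simp: stable_subordinator_def)
  have Y_le: "\<P>(\<omega> in M. ?V \<omega> < s) \<le> \<P>(\<omega> in M. ?Y \<omega> \<le> s)" if s: "0 \<le> s" for s
  proof -
    have "?Y \<omega> \<le> s" if "t < D s \<omega>" for \<omega>
      using that s unfolding first_hitting_time_def by (auto intro!: cInf_lower bdd_belowI[of _ 0])
    thus ?thesis unfolding subordinator_prob_gt[OF s t, symmetric]
      using s by (intro finite_measure_mono) auto
  qed
  have Y_less: "\<P>(\<omega> in M. ?Y \<omega> < s) \<le> \<P>(\<omega> in M. ?V \<omega> < s)" if s: "0 \<le> s" for s
    unfolding subordinator_prob_gt[OF s t, symmetric]
  proof (rule finite_measure_mono_AE)
    show "AE \<omega> in M. \<omega> \<in> {\<omega> \<in> space M. ?Y \<omega> < s} \<longrightarrow> \<omega> \<in> {\<omega> \<in> space M. t < D s \<omega>}"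
      using subordinator_unbounded[of t]
    proof eventually_elim
      case (elim \<omega>)
      show ?case
      proof (intro impI, safe)
        assume \<omega>: "\<omega> \<in> space M" and "?Y \<omega> < s"
        hence "Inf {s. 0 \<le> s \<and> t < D s \<omega>} < s" using elim by (auto simp: first_hitting_time_def)
        then obtain r where "0 \<le> r" "t < D r \<omega>" "r < s"
          using elim by (subst (asm) cInf_less_iff) (auto intro!: bdd_belowI[of _ 0])
        thus "t < D s \<omega>" using mono[OF \<omega>] by (auto dest: mono_onD[of _ _ r s])
      qed
    qed
  qed (use s in auto)
  define N where "N = distr M borel ?Y"
  define N' where "N' = distr M borel ?V"
  interpret N: real_distribution N unfolding N_def by simp
  interpret N': real_distribution N' unfolding N'_def by simp
  have cdfN: "cdf N x = \<P>(\<omega> in M. ?Y \<omega> \<le> x)" and cdfN': "cdf N' x = \<P>(\<omega> in M. ?V \<omega> \<le> x)" for x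
    unfolding N_def N'_def cdf_def by (subst measure_distr; auto intro!: arg_cong[where f = "measure M"])+
  have right: "((\<lambda>r. cdf K r) \<longlongrightarrow> cdf K x) (at_right x)" if "real_distribution K" for K x
    using finite_borel_measure.cdf_is_right_cont[OF real_distribution.finite_borel_measure_M[OF that], of x]
    by (simp add: continuous_within)
  have "cdf N x = cdf N' x" for x
  proof (cases "x < 0")
    case True
    have "\<not> ?Y \<omega> \<le> x" "\<not> ?V \<omega> \<le> x" for \<omega>
      using True first_hitting_time_nonneg[of t \<omega>]
        mult_nonneg_nonneg[OF powr_ge_zero powr_ge_zero, of t \<alpha> "D 1 \<omega>" "- \<alpha>"] by linarith+
    thus ?thesis by (simp add: cdfN cdfN')
  next
    case False
    hence x: "0 \<le> x" by simp
    \<comment> \<open>The interlacing: each distribution function at \<open>x\<close> is at most the other one at any \<open>r > x\<close>.\<close>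
    have 1: "cdf N' x \<le> cdf N r" if "x < r" for r
    proof -
      have "cdf N' x \<le> \<P>(\<omega> in M. ?V \<omega> < r)" unfolding cdfN' using that by (intro finite_measure_mono) auto
      also have "\<dots> \<le> cdf N r" unfolding cdfN using that x by (intro Y_le) simp
      finally show ?thesis .
    qed
    have 2: "cdf N x \<le> cdf N' r" if "x < r" for r
    proof -
      have "cdf N x \<le> \<P>(\<omega> in M. ?Y \<omega> < r)" unfolding cdfN using that by (intro finite_measure_mono) auto
      also have "\<dots> \<le> \<P>(\<omega> in M. ?V \<omega> < r)" using that x by (intro Y_less) simp
      also have "\<dots> \<le> cdf N' r" unfolding cdfN' by (intro finite_measure_mono) auto
      finally show ?thesis .
    qed
    show ?thesis
    proof (rule antisym)
      show "cdf N x \<le> cdf N' x"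
        by (rule tendsto_lowerbound[OF right[OF N'.real_distribution_axioms]])
           (auto simp: eventually_at_right_field intro!: exI[of _ "x+1"] 2)
      show "cdf N' x \<le> cdf N x"
        by (rule tendsto_lowerbound[OF right[OF N.real_distribution_axioms]])
           (auto simp: eventually_at_right_field intro!: exI[of _ "x+1"] 1)
    qed
  qed
  thus ?thesis
    using cdf_unique[OF N.real_distribution_axioms N'.real_distribution_axioms] by (auto simp: N_def N'_def)
qed

end

section \<open>Moments of the inverse stable subordinator\<close>

lemma nn_integral_Gamma_scaled:
  fixes a x :: real
  assumes "0 < a" "0 < x"
  shows "(\<integral>\<^sup>+z. ennreal (indicator {0..} z * z powr (a - 1) * exp (- z * x)) \<partial>lborel)
           = ennreal (Gamma a * x powr - a)"
proof -
  have "ennreal (Gamma a) = (\<integral>\<^sup>+t. ennreal (indicator {0..} t * t powr (a - 1) / exp t) \<partial>lborel)"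
    by (rule Gamma_conv_nn_integral_real[OF assms(1)])
  also have "\<dots> = ennreal \<bar>x\<bar> * (\<integral>\<^sup>+z. ennreal (indicator {0..} (0 + x * z) * (0 + x * z) powr (a - 1) / exp (0 + x * z)) \<partial>lborel)"
    by (rule nn_integral_real_affine) (use assms in auto)
  also have "\<dots> = (\<integral>\<^sup>+z. ennreal (x powr a) * ennreal (indicator {0..} z * z powr (a - 1) * exp (- z * x)) \<partial>lborel)"
  proof (subst nn_integral_cmult[symmetric], measurable, intro nn_integral_cong)
    fix z :: real
    have "x * (indicator {0..} (0 + x * z) * (0 + x * z) powr (a - 1) / exp (0 + x * z))
      = x powr a * (indicator {0..} z * z powr (a - 1) * exp (- z * x))"
      using assms by (auto simp: indicator_def zero_le_mult_iff powr_mult exp_minus divide_inverse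
          powr_diff mult_ac split: if_splits)
    thus "ennreal \<bar>x\<bar> * ennreal (indicator {0..} (0 + x * z) * (0 + x * z) powr (a - 1) / exp (0 + x * z))
      = ennreal (x powr a) * ennreal (indicator {0..} z * z powr (a - 1) * exp (- z * x))"
      using assms by (simp add: ennreal_mult'[symmetric])
  qed
  also have "\<dots> = ennreal (x powr a) * (\<integral>\<^sup>+z. ennreal (indicator {0..} z * z powr (a - 1) * exp (- z * x)) \<partial>lborel)"
    by (rule nn_integral_cmult) measurable
  finally have "ennreal (x powr - a) * ennreal (Gamma a) = ennreal (x powr - a) * ennreal (x powr a) *
     (\<integral>\<^sup>+z. ennreal (indicator {0..} z * z powr (a - 1) * exp (- z * x)) \<partial>lborel)"
    by (simp add: mult.assoc)
  moreover have "ennreal (x powr - a) * ennreal (x powr a) = 1"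
    using assms by (simp add: ennreal_mult'[symmetric] powr_add[symmetric])
  moreover have "ennreal (Gamma a * x powr - a) = ennreal (x powr - a) * ennreal (Gamma a)"
    by (subst mult.commute, rule ennreal_mult') simp
  ultimately show ?thesis by simp
qed

text \<open>
  The Gamma integral under the substitution \<open>u = z powr \<alpha>\<close>.
\<close>

lemma nn_integral_Gamma_powr:
  fixes \<alpha> b :: real
  assumes "0 < \<alpha>" "0 < b"
  shows "(\<integral>\<^sup>+z. ennreal (indicator {0<..} z * z powr (\<alpha> * b - 1) * exp (- (z powr \<alpha>))) \<partial>lborel)
           = ennreal (Gamma b / \<alpha>)"
proof -
  define f where "f = (\<lambda>u::real. u powr (b - 1) / exp u)"
  have "(f has_integral Gamma b) {0..}" unfolding f_def by (rule Gamma_integral_real[OF assms(2)])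
  moreover have "(f has_integral Gamma b) {0..} \<longleftrightarrow> (f has_integral Gamma b) {0<..}"
  proof (rule has_integral_spike_set_eq)
    show "negligible {x \<in> {0..} - {0<..}. f x \<noteq> 0}"
      by (rule negligible_subset[of "{0}"]) auto
    have "{x \<in> {0<..} - {0..}. f x \<noteq> 0} = {}" by auto
    thus "negligible {x \<in> {0<..} - {0..}. f x \<noteq> 0}" by (metis negligible_empty)
  qed
  ultimately have int: "(f has_integral Gamma b) {0<..}" by blast
  hence "f absolutely_integrable_on {0<..}"
    by (intro nonnegative_absolutely_integrable_1) (auto simp: f_def has_integral_integrable)
  have img: "(\<lambda>z. z powr \<alpha>) ` {0<..} = {0<..}"
  proof (intro equalityI subsetI)
    fix u :: real assume "u \<in> {0<..}"
    thus "u \<in> (\<lambda>z. z powr \<alpha>) ` {0<..}"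
      using assms by (intro image_eqI[of _ _ "u powr (1/\<alpha>)"]) (auto simp: powr_powr)
  qed auto
  have "(\<lambda>z. \<bar>\<alpha> * z powr (\<alpha> - 1)\<bar> * f (z powr \<alpha>)) absolutely_integrable_on {0<..} \<and>
        integral {0<..} (\<lambda>z. \<bar>\<alpha> * z powr (\<alpha> - 1)\<bar> * f (z powr \<alpha>)) = Gamma b"
  proof (rule has_absolute_integral_change_of_variables_1'[where g = "\<lambda>z. z powr \<alpha>" and f = f, THEN iffD2])
    show "((\<lambda>z. z powr \<alpha>) has_real_derivative \<alpha> * z powr (\<alpha> - 1)) (at z within {0<..})" if "z \<in> {0<..}" for z
      by (rule has_field_derivative_at_within[OF has_real_derivative_powr]) (use that in auto)
    show "inj_on (\<lambda>z. z powr \<alpha>) {0<..}"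
    proof (rule inj_onI)
      fix x y :: real assume "x \<in> {0<..}" "y \<in> {0<..}" "x powr \<alpha> = y powr \<alpha>"
      thus "x = y" using assms by (metis greaterThan_iff powr_inj powr_less_mono2 less_imp_le linorder_neqE_linordered_idom order_less_irrefl)
    qed
    show "f absolutely_integrable_on (\<lambda>z. z powr \<alpha>) ` {0<..} \<and> integral ((\<lambda>z. z powr \<alpha>) ` {0<..}) f = Gamma b"
      unfolding img using int \<open>f absolutely_integrable_on _\<close> by (simp add: integral_unique)
  qed simp
  hence "((\<lambda>z. \<bar>\<alpha> * z powr (\<alpha> - 1)\<bar> * f (z powr \<alpha>)) has_integral Gamma b) {0<..}"
    by (metis absolutely_integrable_on_def has_integral_integrable_integral)
  hence "((\<lambda>z. (\<bar>\<alpha> * z powr (\<alpha> - 1)\<bar> * f (z powr \<alpha>)) / \<alpha>) has_integral Gamma b / \<alpha>) {0<..}"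
    by (rule has_integral_divide)
  hence "(\<integral>\<^sup>+z. ennreal (indicator {0<..} z * ((\<bar>\<alpha> * z powr (\<alpha> - 1)\<bar> * f (z powr \<alpha>)) / \<alpha>)) \<partial>lborel) = ennreal (Gamma b / \<alpha>)"
    by (intro nn_integral_has_integral_lebesgue) (use assms in \<open>auto simp: f_def\<close>)
  also have "(\<lambda>z. indicator {0<..} z * ((\<bar>\<alpha> * z powr (\<alpha> - 1)\<bar> * f (z powr \<alpha>)) / \<alpha>))
     = (\<lambda>z. indicator {0<..} z * z powr (\<alpha> * b - 1) * exp (- (z powr \<alpha>)))"
    using assms by (auto simp: f_def indicator_def fun_eq_iff powr_powr exp_minus divide_inverse
        powr_add[symmetric] algebra_simps)
  finally show ?thesis .
qed

lemma nn_integral_Beta_scaled: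
  fixes a b t :: real
  assumes "0 < a" "0 < b" "0 < t"
  shows "(\<integral>\<^sup>+y. ennreal (indicator {0<..<t} y * ((t - y) powr (b - 1) * y powr (a - 1))) \<partial>lborel)
           = ennreal (t powr (a + b - 1) * Beta a b)"
proof -
  have "((\<lambda>u. u powr (a - 1) * (1 - u) powr (b - 1)) has_integral Beta a b) {0<..<1}"
    using has_integral_Beta_real[OF assms(1,2)] by (simp add: has_integral_Icc_iff_Ioo)
  hence *: "(\<integral>\<^sup>+u. ennreal (indicator {0<..<1} u * (u powr (a - 1) * (1 - u) powr (b - 1))) \<partial>lborel) = ennreal (Beta a b)"
    by (intro nn_integral_has_integral_lebesgue) auto
  have "(\<integral>\<^sup>+y. ennreal (indicator {0<..<t} y * ((t - y) powr (b - 1) * y powr (a - 1))) \<partial>lborel)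
    = ennreal \<bar>t\<bar> * (\<integral>\<^sup>+u. ennreal (indicator {0<..<t} (0 + t * u) * ((t - (0 + t * u)) powr (b - 1) * (0 + t * u) powr (a - 1))) \<partial>lborel)"
    by (rule nn_integral_real_affine) (use assms in auto)
  also have "\<dots> = (\<integral>\<^sup>+u. ennreal (t powr (a + b - 1)) * ennreal (indicator {0<..<1} u * (u powr (a - 1) * (1 - u) powr (b - 1))) \<partial>lborel)"
  proof (subst nn_integral_cmult[symmetric], measurable, intro nn_integral_cong)
    fix u :: real
    have "t * (indicator {0<..<t} (0 + t * u) * ((t - (0 + t * u)) powr (b - 1) * (0 + t * u) powr (a - 1)))
      = t powr (a + b - 1) * (indicator {0<..<1} u * (u powr (a - 1) * (1 - u) powr (b - 1)))"
    proof (cases "0 < u \<and> u < 1")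
      case True
      have "t - t * u = t * (1 - u)" by (simp add: algebra_simps)
      hence "(t - t * u) powr (b - 1) = t powr (b - 1) * (1 - u) powr (b - 1)"
        using True assms by (simp add: powr_mult)
      moreover have "t * (t powr (b - 1) * t powr (a - 1)) = t powr (a + b - 1)"
        using assms by (simp add: powr_add[symmetric] powr_mult_base algebra_simps)
      ultimately show ?thesis using True assms by (simp add: powr_mult mult_ac)
    next
      case False
      thus ?thesis using assms by (auto simp: indicator_def zero_less_mult_iff)
    qed
    thus "ennreal \<bar>t\<bar> * ennreal (indicator {0<..<t} (0 + t * u) * ((t - (0 + t * u)) powr (b - 1) * (0 + t * u) powr (a - 1)))
      = ennreal (t powr (a + b - 1)) * ennreal (indicator {0<..<1} u * (u powr (a - 1) * (1 - u) powr (b - 1)))"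
      using assms by (simp add: ennreal_mult'[symmetric])
  qed
  also have "\<dots> = ennreal (t powr (a + b - 1)) * ennreal (Beta a b)"
    by (subst nn_integral_cmult) (use * in auto)
  finally show ?thesis by (simp add: ennreal_mult')
qed

text \<open>
  Keep only the part of the Gamma integral beyond \<open>A\<close>.  As \<open>A\<close> is free, the Gamma function outgrows
  every exponential, which is all that the series of Mittag-Leffler type below requires.
\<close>

lemma Gamma_ge_powr_exp:
  fixes A x :: real
  assumes "0 < A" "0 \<le> x"
  shows "A powr x * exp (- A) \<le> Gamma (1 + x)"
proof -
  have "(\<integral>\<^sup>+t. ennreal (exp (- t)) * indicator {A..} t \<partial>lborel) = ennreal (0 - (- exp (- A)))"
  proof (rule nn_integral_FTC_atLeast)
    show "((\<lambda>t::real. - exp (- t)) \<longlongrightarrow> 0) at_top" by real_asymp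
  qed (auto intro!: derivative_eq_intros)
  hence tail: "(\<integral>\<^sup>+t. ennreal (exp (- t)) * indicator {A..} t \<partial>lborel) = ennreal (exp (- A))" by simp
  have "ennreal (A powr x * exp (- A)) = ennreal (A powr x) * (\<integral>\<^sup>+t. ennreal (exp (- t)) * indicator {A..} t \<partial>lborel)"
    by (simp add: tail ennreal_mult')
  also have "\<dots> = (\<integral>\<^sup>+t. ennreal (A powr x) * (ennreal (exp (- t)) * indicator {A..} t) \<partial>lborel)"
    by (rule nn_integral_cmult[symmetric]) measurable
  also have "\<dots> \<le> (\<integral>\<^sup>+t. ennreal (indicator {0..} t * t powr ((1 + x) - 1) / exp t) \<partial>lborel)"
  proof (rule nn_integral_mono)
    fix t :: real
    show "ennreal (A powr x) * (ennreal (exp (- t)) * indicator {A..} t) \<le> ennreal (indicator {0..} t * t powr ((1 + x) - 1) / exp t)"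
    proof (cases "A \<le> t")
      case True
      thus ?thesis using assms
        by (auto simp: indicator_def ennreal_mult'[symmetric] exp_minus divide_inverse intro!: ennreal_leI mult_right_mono powr_mono2)
    qed simp
  qed
  also have "\<dots> = ennreal (Gamma (1 + x))"
    by (rule Gamma_conv_nn_integral_real[symmetric]) (use assms in auto)
  finally show ?thesis using assms Gamma_real_pos[of "1 + x"] by (subst (asm) ennreal_le_iff) auto
qed

lemma summable_mittag_leffler:
  fixes \<alpha> \<theta> :: real
  assumes "0 < \<alpha>" "0 \<le> \<theta>"
  shows "summable (\<lambda>n. \<theta> ^ n / Gamma (1 + real n * \<alpha>))"
proof (rule summable_comparison_test'[of _ 0])
  \<comment> \<open>With this \<open>A\<close> the bound \<open>A powr (n * \<alpha>) * exp (- A)\<close> for the Gamma function beats \<open>\<theta> ^ n\<close> by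
    a geometric factor; the \<open>1\<close> keeps \<open>A\<close> positive for \<open>\<theta> = 0\<close>.\<close>
  define A where "A = (2 * \<theta> + 1) powr (1 / \<alpha>)"
  have A: "0 < A" "A powr (real n * \<alpha>) = (2 * \<theta> + 1) ^ n" for n
    using assms by (auto simp: A_def powr_powr powr_realpow)
  show "summable (\<lambda>n. exp A * (1/2) ^ n)" by (intro summable_mult summable_geometric) simp
  fix n
  have "(2 * \<theta> + 1) ^ n * exp (- A) \<le> Gamma (1 + real n * \<alpha>)"
    using Gamma_ge_powr_exp[OF A(1), of "real n * \<alpha>"] assms A(2)[of n] by simp
  moreover have "0 < (2 * \<theta> + 1) ^ n * exp (- A)" using assms by auto
  ultimately have "\<theta> ^ n / Gamma (1 + real n * \<alpha>) \<le> \<theta> ^ n / ((2 * \<theta> + 1) ^ n * exp (- A))"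
    using assms by (intro divide_left_mono mult_pos_pos) (auto intro!: Gamma_real_pos add_pos_nonneg)
  also have "\<dots> = exp A * (\<theta> / (2 * \<theta> + 1)) ^ n"
    by (simp add: power_divide exp_minus) (simp add: field_simps)
  also have "\<dots> \<le> exp A * (1/2) ^ n"
    using assms by (intro mult_left_mono power_mono) (auto simp: divide_simps)
  finally show "norm (\<theta> ^ n / Gamma (1 + real n * \<alpha>)) \<le> exp A * (1/2) ^ n"
    using assms Gamma_real_pos[of "1 + real n * \<alpha>"] by (simp add: add_pos_nonneg)
qed

text \<open>
  Negative moments from the Laplace transform: integrating \<open>z powr (a - 1) * E (exp (- z * D 1))\<close> over
  \<open>z > 0\<close> with \<open>a = n * \<alpha>\<close> gives \<open>Gamma a * E (D 1 powr - a)\<close> by Tonelli, and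
  \<open>Gamma n / \<alpha>\<close> when the transform \<open>exp (- z powr \<alpha>)\<close> is inserted.
\<close>

lemma subordinator_moment:
  fixes M :: "'w measure"
  assumes M: "prob_space M" and \<alpha>: "0 < \<alpha>" and D: "stable_subordinator M \<alpha> D"
  shows "has_bochner_integral M (\<lambda>\<omega>. (D 1 \<omega> powr - \<alpha>) ^ n) (fact n / Gamma (1 + real n * \<alpha>))"
proof (cases "n = 0")
  case True
  interpret prob_space M by fact
  show ?thesis using True by (simp add: has_bochner_integral_iff prob_space)
next
  case False
  interpret prob_space M by fact
  interpret pair_sigma_finite M lborel ..
  have [measurable]: "D 1 \<in> borel_measurable M"
    by (rule subordinator_measurable[OF M \<alpha> D]) simp
  define a where "a = \<alpha> * real n"
  have a: "0 < a" using False \<alpha> by (simp add: a_def)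
  have Ga: "0 < Gamma a" using a by (rule Gamma_real_pos)
  have pos: "AE \<omega> in M. 0 < D 1 \<omega>" by (rule subordinator_pos[OF M \<alpha> D]) simp
  have "ennreal (Gamma a) * (\<integral>\<^sup>+\<omega>. ennreal (D 1 \<omega> powr - a) \<partial>M) = (\<integral>\<^sup>+\<omega>. ennreal (Gamma a * D 1 \<omega> powr - a) \<partial>M)"
    using Ga by (subst nn_integral_cmult[symmetric]) (auto simp: ennreal_mult')
  also have "\<dots> = (\<integral>\<^sup>+\<omega>. (\<integral>\<^sup>+z. ennreal (indicator {0..} z * z powr (a - 1) * exp (- z * D 1 \<omega>)) \<partial>lborel) \<partial>M)"
    by (rule nn_integral_cong_AE) (use pos in eventually_elim, simp only: nn_integral_Gamma_scaled[OF a])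
  also have "\<dots> = (\<integral>\<^sup>+z. (\<integral>\<^sup>+\<omega>. ennreal (indicator {0..} z * z powr (a - 1) * exp (- z * D 1 \<omega>)) \<partial>M) \<partial>lborel)"
    by (rule Fubini'[symmetric]) measurable
  also have "\<dots> = (\<integral>\<^sup>+z. ennreal (indicator {0<..} z * z powr (\<alpha> * real n - 1) * exp (- (z powr \<alpha>))) \<partial>lborel)"
  proof (rule nn_integral_cong)
    fix z :: real
    show "(\<integral>\<^sup>+\<omega>. ennreal (indicator {0..} z * z powr (a - 1) * exp (- z * D 1 \<omega>)) \<partial>M)
        = ennreal (indicator {0<..} z * z powr (\<alpha> * real n - 1) * exp (- (z powr \<alpha>)))"
    proof (cases "0 < z")
      case True
      have "has_bochner_integral M (\<lambda>\<omega>. exp (- z * D 1 \<omega>)) (exp (- 1 * z powr \<alpha>))"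
        by (rule subordinator_laplace[OF M \<alpha> D _ True]) simp
      hence "(\<integral>\<^sup>+\<omega>. ennreal (exp (- z * D 1 \<omega>)) \<partial>M) = ennreal (exp (- (z powr \<alpha>)))"
        by (subst nn_integral_eq_integral) (auto simp: has_bochner_integral_iff)
      thus ?thesis using True
        by (simp add: ennreal_mult' nn_integral_cmult a_def)
    qed (cases "z = 0"; simp)
  qed
  also have "\<dots> = ennreal (Gamma (real n) / \<alpha>)"
    using False \<alpha> by (intro nn_integral_Gamma_powr) auto
  finally have "ennreal (1 / Gamma a) * (ennreal (Gamma a) * (\<integral>\<^sup>+\<omega>. ennreal (D 1 \<omega> powr - a) \<partial>M))
      = ennreal (1 / Gamma a) * ennreal (Gamma (real n) / \<alpha>)" by simp
  moreover have "ennreal (1 / Gamma a) * ennreal (Gamma a) = 1"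
    using Ga by (simp add: ennreal_mult'[symmetric])
  moreover have "1 / Gamma a * (Gamma (real n) / \<alpha>) = fact n / Gamma (1 + real n * \<alpha>)"
  proof -
    have "Gamma (1 + real n * \<alpha>) = a * Gamma a"
      using Gamma_plus1[of a] a nonpos_Ints_nonpos[of a]
      by (fastforce simp: a_def add.commute mult.commute)
    moreover have "fact n = real n * Gamma (real n)"
      using False Gamma_fact[of "n - 1", where 'a = real] fact_reduce[of n, where 'a = real] by simp
    ultimately show ?thesis using False \<alpha> Ga by (simp add: a_def field_simps)
  qed
  ultimately have "(\<integral>\<^sup>+\<omega>. ennreal (D 1 \<omega> powr - a) \<partial>M) = ennreal (fact n / Gamma (1 + real n * \<alpha>))"
    using Ga by (simp add: mult.assoc[symmetric] ennreal_mult'[symmetric])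
  hence "(\<integral>\<^sup>+\<omega>. ennreal ((D 1 \<omega> powr - \<alpha>) ^ n) \<partial>M) = ennreal (fact n / Gamma (1 + real n * \<alpha>))"
  proof -
    have "(D 1 \<omega> powr - \<alpha>) ^ n = D 1 \<omega> powr - a" for \<omega>
      using False by (cases "D 1 \<omega> = 0") (auto simp: a_def powr_power mult.commute)
    thus ?thesis using \<open>(\<integral>\<^sup>+\<omega>. ennreal (D 1 \<omega> powr - a) \<partial>M) = _\<close> by simp
  qed
  thus ?thesis
    using \<alpha> Gamma_real_pos[of "1 + real n * \<alpha>"]
    by (intro has_bochner_integral_nn_integral) (auto simp: add_pos_nonneg)
qed

section \<open>Caputo derivatives of Mittag-Leffler mixtures\<close>

text \<open>
  \<open>F\<close> is Lipschitz with constant \<open>C\<close>, so the difference quotients in \<open>v\<close> are dominated by \<open>C * W\<close>.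
  The functions are controlled on the half-line only; composing with \<open>max 0\<close> extends them to Borel
  functions on the line, so that increments of \<open>v\<close> to negative values are dominated as well.
\<close>

lemma (in prob_space) has_real_derivative_expectation_scale:
  fixes F G :: "real \<Rightarrow> real" and W :: "'a \<Rightarrow> real"
  assumes W: "integrable M W" "\<And>\<omega>. 0 \<le> W \<omega>"
    and F: "\<And>s. 0 \<le> s \<Longrightarrow> (F has_real_derivative G s) (at s within {0..})"
    and G: "\<And>s. 0 \<le> s \<Longrightarrow> \<bar>G s\<bar> \<le> C" and bnd: "\<And>s. 0 \<le> s \<Longrightarrow> \<bar>F s\<bar> \<le> B"
    and contG: "continuous_on {0..} G"
  shows "continuous_on {0..} (\<lambda>v. \<integral>\<omega>. F (v * W \<omega>) \<partial>M)"
    and "0 < v \<Longrightarrow> ((\<lambda>v. \<integral>\<omega>. F (v * W \<omega>) \<partial>M) has_real_derivative (\<integral>\<omega>. W \<omega> * G (v * W \<omega>) \<partial>M)) (at v)"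
proof -
  have [measurable]: "W \<in> borel_measurable M" using W by simp
  define F' where "F' x = F (max 0 x)" for x
  have lip: "\<bar>F x - F y\<bar> \<le> C * \<bar>x - y\<bar>" if "0 \<le> x" "0 \<le> y" for x y
    using field_differentiable_bound[of "{0..}" F G C x y] F G that by auto
  have "C \<ge> 0" using G[of 0] by simp
  have lip': "\<bar>F' x - F' y\<bar> \<le> C * \<bar>x - y\<bar>" for x y
  proof -
    have "\<bar>F' x - F' y\<bar> \<le> C * \<bar>max 0 x - max 0 y\<bar>" unfolding F'_def by (rule lip) auto
    also have "\<dots> \<le> C * \<bar>x - y\<bar>" using \<open>C \<ge> 0\<close> by (intro mult_left_mono) (auto simp: max_def)
    finally show ?thesis .
  qed
  have "continuous_on {0..} F"
    by (rule DERIV_continuous_on[where D = G], rule F) simp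
  hence "continuous_on UNIV F'"
    unfolding F'_def by (rule continuous_on_compose2[where g = F]) (auto intro!: continuous_intros)
  hence [measurable]: "F' \<in> borel_measurable borel" by (rule borel_measurable_continuous_onI)
  have "continuous_on UNIV (\<lambda>x. G (max 0 x))"
    by (rule continuous_on_compose2[OF contG]) (auto intro!: continuous_intros)
  hence [measurable]: "(\<lambda>x. G (max 0 x)) \<in> borel_measurable borel" by (rule borel_measurable_continuous_onI)
  define H where "H v = (\<integral>\<omega>. F' (v * W \<omega>) \<partial>M)" for v
  have HF: "H v = (\<integral>\<omega>. F (v * W \<omega>) \<partial>M)" if "0 \<le> v" for v
    using that W by (simp add: H_def F'_def max_def)
  have int: "integrable M (\<lambda>\<omega>. F' (v * W \<omega>))" for v
  proof (rule integrable_const_bound[of _ B])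
    show "AE \<omega> in M. norm (F' (v * W \<omega>)) \<le> B" unfolding F'_def by (auto intro!: bnd)
  qed simp
  have diff: "H v - H u = (\<integral>\<omega>. F' (v * W \<omega>) - F' (u * W \<omega>) \<partial>M)" for v u
    unfolding H_def by (rule Bochner_Integration.integral_diff[OF int int, symmetric])
  have ptw: "\<bar>F' (v * W \<omega>) - F' (u * W \<omega>)\<bar> \<le> C * \<bar>v - u\<bar> * W \<omega>" for v u \<omega>
    using lip'[of "v * W \<omega>" "u * W \<omega>"] W(2)[of \<omega>] by (simp add: left_diff_distrib[symmetric] abs_mult mult.assoc)
  have lipH: "\<bar>H v - H u\<bar> \<le> C * (\<integral>\<omega>. W \<omega> \<partial>M) * \<bar>v - u\<bar>" for v u
  proof -
    have "\<bar>H v - H u\<bar> \<le> (\<integral>\<omega>. \<bar>F' (v * W \<omega>) - F' (u * W \<omega>)\<bar> \<partial>M)"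
      unfolding diff by (rule integral_abs_bound)
    also have "\<dots> \<le> (\<integral>\<omega>. C * \<bar>v - u\<bar> * W \<omega> \<partial>M)"
      by (intro integral_mono ptw) (use int W in auto)
    finally show ?thesis by (simp add: mult_ac)
  qed
  have "continuous_on UNIV H"
  proof (rule continuous_at_imp_continuous_on, rule ballI)
    fix u
    have "((\<lambda>v. H v - H u) \<longlongrightarrow> 0) (at u)"
    proof (rule Lim_null_comparison)
      show "((\<lambda>v. C * (\<integral>\<omega>. W \<omega> \<partial>M) * \<bar>v - u\<bar>) \<longlongrightarrow> 0) (at u)"
        by (auto intro!: tendsto_eq_intros)
    qed (use lipH in auto)
    thus "isCont H u" unfolding isCont_def by (simp add: LIM_zero_iff)
  qed
  thus "continuous_on {0..} (\<lambda>v. \<integral>\<omega>. F (v * W \<omega>) \<partial>M)"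
    by (rule continuous_on_eq[OF continuous_on_subset[of UNIV H]]) (use HF in auto)
  assume v: "0 < v"
  have "(H has_real_derivative (\<integral>\<omega>. W \<omega> * G (max 0 (v * W \<omega>)) \<partial>M)) (at v)"
    unfolding DERIV_def tendsto_at_iff_sequentially comp_def
  proof (intro allI impI)
    fix X :: "nat \<Rightarrow> real" assume X: "\<forall>i. X i \<in> UNIV - {0}" "X \<longlonglongrightarrow> 0"
    have "(\<lambda>i. \<integral>\<omega>. (F' ((v + X i) * W \<omega>) - F' (v * W \<omega>)) / X i \<partial>M) \<longlonglongrightarrow> (\<integral>\<omega>. W \<omega> * G (max 0 (v * W \<omega>)) \<partial>M)"
    proof (rule integral_dominated_convergence[where w = "\<lambda>\<omega>. C * W \<omega>"])
      show "AE \<omega> in M. norm ((F' ((v + X i) * W \<omega>) - F' (v * W \<omega>)) / X i) \<le> C * W \<omega>" for i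
        using X(1) ptw[of "v + X i" _ v] by (auto simp: divide_le_eq mult_ac)
      show "AE \<omega> in M. (\<lambda>i. (F' ((v + X i) * W \<omega>) - F' (v * W \<omega>)) / X i) \<longlonglongrightarrow> W \<omega> * G (max 0 (v * W \<omega>))"
      proof (rule AE_I2)
        fix \<omega>
        show "(\<lambda>i. (F' ((v + X i) * W \<omega>) - F' (v * W \<omega>)) / X i) \<longlonglongrightarrow> W \<omega> * G (max 0 (v * W \<omega>))"
        proof (cases "W \<omega> = 0")
          case False
          hence pos: "0 < W \<omega>" "0 < v * W \<omega>" using W(2)[of \<omega>] v by auto
          define x where "x = v * W \<omega>"
          have x: "0 < x" using pos by (simp add: x_def)
          hence "at x within {0..} = at x"
            by (intro at_within_open_subset[of _ "{0<..}"]) auto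
          hence "(F has_real_derivative G x) (at x)" using F[of x] x by simp
          hence "(F' has_real_derivative G x) (at x)"
            by (rule has_field_derivative_transform_within_open[of _ _ _ "{0<..}"]) (use x in \<open>auto simp: F'_def\<close>)
          moreover have "((\<lambda>v. v * W \<omega>) has_real_derivative W \<omega>) (at v)"
            by (auto intro!: derivative_eq_intros)
          ultimately have "((\<lambda>v. F' (v * W \<omega>)) has_real_derivative G x * W \<omega>) (at v)"
            unfolding x_def by (rule DERIV_chain2)
          hence "(\<lambda>i. (F' ((v + X i) * W \<omega>) - F' (v * W \<omega>)) / X i) \<longlonglongrightarrow> G x * W \<omega>"
            using X unfolding DERIV_def tendsto_at_iff_sequentially comp_def by blast
          moreover have "max 0 (v * W \<omega>) = x" using x by (simp add: x_def)
          ultimately show ?thesis by (simp only: mult.commute)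
        qed simp
      qed
    qed (use W in auto)
    thus "(\<lambda>i. (H (v + X i) - H v) / X i) \<longlonglongrightarrow> (\<integral>\<omega>. W \<omega> * G (max 0 (v * W \<omega>)) \<partial>M)"
      by (simp add: diff)
  qed
  hence "(H has_real_derivative (\<integral>\<omega>. W \<omega> * G (v * W \<omega>) \<partial>M)) (at v)"
    using W v by (simp add: max_def)
  thus "((\<lambda>v. \<integral>\<omega>. F (v * W \<omega>) \<partial>M) has_real_derivative (\<integral>\<omega>. W \<omega> * G (v * W \<omega>) \<partial>M)) (at v)"
    by (rule has_field_derivative_transform_within_open[of _ _ _ "{0<..}"]) (use v HF in auto)
qed

text \<open>
  These are the moments of the Mittag-Leffler distribution, whose moment generating function is the
  Mittag-Leffler function \<open>\<theta> \<mapsto> (\<Sum>n. \<theta> ^ n / Gamma (1 + n * \<alpha>))\<close>.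
\<close>

definition mittag_leffler_variable :: "real \<Rightarrow> 'w measure \<Rightarrow> ('w \<Rightarrow> real) \<Rightarrow> bool" where
  "mittag_leffler_variable \<alpha> M W \<longleftrightarrow>
     W \<in> borel_measurable M \<and> (\<forall>\<omega>. 0 \<le> W \<omega>) \<and>
     (\<forall>n. has_bochner_integral M (\<lambda>\<omega>. W \<omega> ^ n) (fact n / Gamma (1 + real n * \<alpha>)))"

text \<open>
  The identity behind the theorem.  In the \<open>n\<close>-th moment of the left-hand side the weight \<open>W\<close> raises the
  power of \<open>W\<close> to \<open>n + 1\<close>, and the integral over \<open>y\<close> is a Beta integral with parameters
  \<open>(n + 1) * \<alpha>\<close> and \<open>1 - \<alpha>\<close>.  Its value cancels against \<open>E (W ^ (n + 1))\<close> to leave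
  \<open>t powr (n * \<alpha>) * E (W ^ n)\<close>.  The case \<open>n = 0\<close> says that the weight is a probability density.
\<close>

lemma (in prob_space) mittag_leffler_size_bias:
  fixes \<alpha> t :: real
  assumes \<alpha>: "0 < \<alpha>" "\<alpha> < 1" and t: "0 < t" and W: "mittag_leffler_variable \<alpha> M W"
  defines "w \<equiv> \<lambda>(y, \<omega>). indicator {0<..<t} y * (1 / Gamma (1 - \<alpha>) * (t - y) powr - \<alpha> * (\<alpha> * y powr (\<alpha> - 1)) * W \<omega>)"
  shows "distr (density (lborel \<Otimes>\<^sub>M M) w) borel (\<lambda>(y, \<omega>). y powr \<alpha> * W \<omega>) = distr M borel (\<lambda>\<omega>. t powr \<alpha> * W \<omega>)"
proof -
  interpret P: pair_sigma_finite lborel M ..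
  have [measurable]: "W \<in> borel_measurable M" using W by (auto simp: mittag_leffler_variable_def)
  have W0: "0 \<le> W \<omega>" for \<omega> using W by (auto simp: mittag_leffler_variable_def)
  have mom: "has_bochner_integral M (\<lambda>\<omega>. W \<omega> ^ n) (fact n / Gamma (1 + real n * \<alpha>))" for n
    using W by (auto simp: mittag_leffler_variable_def)
  have [measurable]: "w \<in> borel_measurable (lborel \<Otimes>\<^sub>M M)" unfolding w_def by measurable
  define K where "K = distr (density (lborel \<Otimes>\<^sub>M M) w) borel (\<lambda>(y, \<omega>). y powr \<alpha> * W \<omega>)"
  define m where "m n = t powr (\<alpha> * real n) * (fact n / Gamma (1 + real n * \<alpha>))" for n
  have G1: "0 < Gamma (1 - \<alpha>)" using \<alpha> by (intro Gamma_real_pos) simp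
  have Gn: "0 < Gamma (1 + real n * \<alpha>)" for n using \<alpha> by (intro Gamma_real_pos) (simp add: add_pos_nonneg)
  have w0: "0 \<le> w z" for z using W0 G1 \<alpha> by (auto simp: w_def split: prod.split)
  have nnK: "(\<integral>\<^sup>+x. ennreal (x ^ n) \<partial>K) = ennreal (m n)" for n
  proof -
    define b where "b = \<alpha> * real (Suc n)"
    have b: "0 < b" using \<alpha> by (simp add: b_def)
    have Gb: "0 < Gamma b" using b by (rule Gamma_real_pos)
    have "(\<integral>\<^sup>+x. ennreal (x ^ n) \<partial>K) = (\<integral>\<^sup>+z. ennreal (w z) * ennreal ((case z of (y, \<omega>) \<Rightarrow> y powr \<alpha> * W \<omega>) ^ n) \<partial>(lborel \<Otimes>\<^sub>M M))"
      unfolding K_def by (subst nn_integral_distr) (auto simp: nn_integral_density)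
    also have "\<dots> = (\<integral>\<^sup>+y. \<integral>\<^sup>+\<omega>. ennreal (w (y, \<omega>)) * ennreal ((y powr \<alpha> * W \<omega>) ^ n) \<partial>M \<partial>lborel)"
      by (subst nn_integral_fst[symmetric]) auto
    also have "\<dots> = (\<integral>\<^sup>+y. ennreal (\<alpha> / Gamma (1 - \<alpha>) * (fact (Suc n) / Gamma (1 + real (Suc n) * \<alpha>))) *
        ennreal (indicator {0<..<t} y * ((t - y) powr ((1 - \<alpha>) - 1) * y powr (b - 1))) \<partial>lborel)"
    proof (rule nn_integral_cong)
      fix y :: real
      define c where "c = \<alpha> / Gamma (1 - \<alpha>) * (indicator {0<..<t} y * ((t - y) powr ((1 - \<alpha>) - 1) * y powr (b - 1)))"
      have c0: "0 \<le> c" using \<alpha> G1 by (simp add: c_def)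
      have "w (y, \<omega>) * (y powr \<alpha> * W \<omega>) ^ n = c * W \<omega> ^ Suc n" for \<omega>
      proof (cases "y \<in> {0<..<t}")
        case True
        hence "y powr (\<alpha> - 1) * (y powr \<alpha>) ^ n = y powr (b - 1)"
          by (simp add: b_def powr_power powr_add[symmetric] algebra_simps)
        thus ?thesis using True by (simp add: w_def c_def power_mult_distrib mult_ac)
      qed (simp add: w_def c_def)
      hence "(\<integral>\<^sup>+\<omega>. ennreal (w (y, \<omega>)) * ennreal ((y powr \<alpha> * W \<omega>) ^ n) \<partial>M) = (\<integral>\<^sup>+\<omega>. ennreal c * ennreal (W \<omega> ^ Suc n) \<partial>M)"
        using w0 c0 by (simp add: ennreal_mult'[symmetric] del: power_Suc)
      also have "\<dots> = ennreal c * ennreal (fact (Suc n) / Gamma (1 + real (Suc n) * \<alpha>))"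
        using mom[of "Suc n"] W0 by (subst nn_integral_cmult, simp, subst nn_integral_eq_integral) (auto simp: has_bochner_integral_iff)
      also have "\<dots> = ennreal (\<alpha> / Gamma (1 - \<alpha>) * (fact (Suc n) / Gamma (1 + real (Suc n) * \<alpha>))) *
        ennreal (indicator {0<..<t} y * ((t - y) powr ((1 - \<alpha>) - 1) * y powr (b - 1)))"
        using c0 \<alpha> G1 Gn[of "Suc n"] by (simp add: ennreal_mult''[symmetric] c_def mult_ac del: fact_Suc of_nat_Suc)
      finally show "(\<integral>\<^sup>+\<omega>. ennreal (w (y, \<omega>)) * ennreal ((y powr \<alpha> * W \<omega>) ^ n) \<partial>M) =
        ennreal (\<alpha> / Gamma (1 - \<alpha>) * (fact (Suc n) / Gamma (1 + real (Suc n) * \<alpha>))) *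
        ennreal (indicator {0<..<t} y * ((t - y) powr ((1 - \<alpha>) - 1) * y powr (b - 1)))" .
    qed
    also have "\<dots> = ennreal (\<alpha> / Gamma (1 - \<alpha>) * (fact (Suc n) / Gamma (1 + real (Suc n) * \<alpha>))) *
        ennreal (t powr (b + (1 - \<alpha>) - 1) * Beta b (1 - \<alpha>))"
      using nn_integral_Beta_scaled[OF b _ t, of "1 - \<alpha>"] \<alpha> by (subst nn_integral_cmult) auto
    also have "\<dots> = ennreal (m n)"
    proof -
      have g1: "Gamma (1 + real (Suc n) * \<alpha>) = b * Gamma b"
        using Gamma_plus1[of b] b nonpos_Ints_nonpos[of b]
        by (fastforce simp: b_def add.commute mult.commute)
      have g2: "Beta b (1 - \<alpha>) = Gamma b * Gamma (1 - \<alpha>) / Gamma (1 + real n * \<alpha>)"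
        by (simp add: Beta_def b_def algebra_simps)
      have g3: "b + (1 - \<alpha>) - 1 = \<alpha> * real n" by (simp add: b_def algebra_simps)
      have g4: "fact (Suc n) / b = fact n / \<alpha>" using \<alpha> by (simp add: b_def)
      have cancel: "a / G * (u / (c * g)) * (T * (g * G / N)) = u / c * a * (T / N)"
        if "G \<noteq> 0" "g \<noteq> 0" for a G u c g T N :: real
        using that by (simp add: divide_simps)
      have "\<alpha> / Gamma (1 - \<alpha>) * (fact (Suc n) / Gamma (1 + real (Suc n) * \<alpha>)) * (t powr (b + (1 - \<alpha>) - 1) * Beta b (1 - \<alpha>))
          = fact (Suc n) / b * \<alpha> * (t powr (\<alpha> * real n) / Gamma (1 + real n * \<alpha>))"
        unfolding g1 g2 g3 by (rule cancel) (use G1 Gb in auto)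
      also have "\<dots> = m n" unfolding g4 using \<alpha> by (simp add: m_def)
      finally have "\<alpha> / Gamma (1 - \<alpha>) * (fact (Suc n) / Gamma (1 + real (Suc n) * \<alpha>)) * (t powr (b + (1 - \<alpha>) - 1) * Beta b (1 - \<alpha>)) = m n" .
      moreover have "0 \<le> \<alpha> / Gamma (1 - \<alpha>) * (fact (Suc n) / Gamma (1 + real (Suc n) * \<alpha>))"
        using \<alpha> G1 Gn[of "Suc n"] by (intro mult_nonneg_nonneg divide_nonneg_pos) auto
      ultimately show ?thesis by (subst ennreal_mult'[symmetric]) auto
    qed
    finally show ?thesis .
  qed
  have m0: "0 \<le> m n" for n using Gn[of n] by (simp add: m_def)
  have "emeasure K (space K) = 1" using nnK[of 0] t by (simp add: m_def)
  hence "prob_space K" by (rule prob_spaceI)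
  hence K: "real_distribution K" by (simp add: real_distribution_def real_distribution_axioms_def K_def)
  have posK: "AE x in K. 0 \<le> x"
    unfolding K_def using W0 by (subst AE_distr_iff) (auto simp: AE_density)
  have "K = distr M borel (\<lambda>\<omega>. t powr \<alpha> * W \<omega>)"
  proof (rule real_distribution_eqI_moments[OF K _ posK])
    show "has_bochner_integral K (\<lambda>x. x ^ n) (m n)" for n
      by (rule has_bochner_integral_nn_integral) (use m0 nnK posK in \<open>auto simp: K_def elim!: eventually_mono\<close>)
    show "has_bochner_integral (distr M borel (\<lambda>\<omega>. t powr \<alpha> * W \<omega>)) (\<lambda>x. x ^ n) (m n)" for n
      using mom[of n] t by (auto simp: has_bochner_integral_iff integrable_distr_eq integral_distr
          power_mult_distrib m_def powr_power mult.commute)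
    fix \<theta> :: real assume "0 < \<theta>"
    hence "summable (\<lambda>n. (\<theta> * t powr \<alpha>) ^ n / Gamma (1 + real n * \<alpha>))"
      by (intro summable_mittag_leffler \<alpha>) simp
    thus "summable (\<lambda>n. \<theta> ^ n * m n / fact n)"
      using t by (simp add: m_def power_mult_distrib powr_power mult.commute[of \<alpha>])
  qed (use W0 in \<open>auto simp: AE_distr_iff\<close>)
  thus ?thesis by (simp add: K_def)
qed

text \<open>
  Substituting \<open>f' y = \<alpha> * y powr (\<alpha> - 1) * E (W * G (y powr \<alpha> * W))\<close> into the Caputo integral gives, by
  Fubini, the integral of \<open>G\<close> with respect to the measure of \<open>mittag_leffler_size_bias\<close>.  Since that
  measure is finite and \<open>G\<close> is bounded, integrability of the Caputo integrand comes out as well.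
\<close>

proposition (in prob_space) has_caputo_derivative_mittag_leffler_mixture:
  fixes F G f :: "real \<Rightarrow> real" and W :: "'a \<Rightarrow> real"
  assumes \<alpha>: "0 < \<alpha>" "\<alpha> < 1" and t: "0 < t" and W: "mittag_leffler_variable \<alpha> M W"
    and F: "\<And>s. 0 \<le> s \<Longrightarrow> (F has_real_derivative G s) (at s within {0..})"
    and G: "\<And>s. 0 \<le> s \<Longrightarrow> \<bar>G s\<bar> \<le> C" and bnd: "\<And>s. 0 \<le> s \<Longrightarrow> \<bar>F s\<bar> \<le> B"
    and contG: "continuous_on {0..} G"
    and f: "\<And>y. 0 \<le> y \<Longrightarrow> f y = (\<integral>\<omega>. F (y powr \<alpha> * W \<omega>) \<partial>M)"
  shows "has_caputo_derivative \<alpha> f (\<integral>\<omega>. G (t powr \<alpha> * W \<omega>) \<partial>M) t"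
proof -
  interpret P: pair_sigma_finite lborel M ..
  have [measurable]: "W \<in> borel_measurable M" using W by (auto simp: mittag_leffler_variable_def)
  have W0: "\<And>\<omega>. 0 \<le> W \<omega>" using W by (auto simp: mittag_leffler_variable_def)
  have intW: "integrable M W"
  proof -
    have "has_bochner_integral M (\<lambda>\<omega>. W \<omega> ^ 1) (fact 1 / Gamma (1 + real 1 * \<alpha>))"
      using W unfolding mittag_leffler_variable_def by blast
    thus ?thesis by (simp add: has_bochner_integral_iff)
  qed
  have G1: "0 < Gamma (1 - \<alpha>)" using \<alpha> by (intro Gamma_real_pos) simp
  define H where "H v = (\<integral>\<omega>. F (v * W \<omega>) \<partial>M)" for v
  define H' where "H' v = (\<integral>\<omega>. W \<omega> * G (v * W \<omega>) \<partial>M)" for v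
  note H = has_real_derivative_expectation_scale[OF intW W0 F G bnd contG, folded H_def H'_def]
  have fH: "f y = H (y powr \<alpha>)" if "0 \<le> y" for y using f[OF that] by (simp add: H_def)
  have cont: "continuous_on {0..t} f"
  proof -
    have "continuous_on {0..t} (\<lambda>y. H (y powr \<alpha>))"
      by (rule continuous_on_compose2[OF H(1) continuous_on_powr'[OF continuous_on_id continuous_on_const]])
         (use \<alpha> in auto)
    thus ?thesis by (rule continuous_on_cong[THEN iffD1, rotated 2]) (auto simp: fH)
  qed
  have der: "(f has_real_derivative \<alpha> * y powr (\<alpha> - 1) * H' (y powr \<alpha>)) (at y)" if "0 < y" for y
  proof -
    have "((\<lambda>y. H (y powr \<alpha>)) has_real_derivative H' (y powr \<alpha>) * (\<alpha> * y powr (\<alpha> - 1))) (at y)"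
      using that by (intro DERIV_chain2[of H] H(2) has_real_derivative_powr) auto
    hence "(f has_real_derivative H' (y powr \<alpha>) * (\<alpha> * y powr (\<alpha> - 1))) (at y)"
      by (rule has_field_derivative_transform_within_open[of _ _ _ "{0<..}"]) (use that fH in auto)
    thus ?thesis by (simp add: mult_ac)
  qed
  define G' where "G' x = G (max 0 x)" for x
  have "continuous_on UNIV G'" unfolding G'_def
    by (rule continuous_on_compose2[OF contG]) (auto intro!: continuous_intros)
  hence [measurable]: "G' \<in> borel_measurable borel" by (rule borel_measurable_continuous_onI)
  define w where "w = (\<lambda>(y, \<omega>). indicator {0<..<t} y * (1 / Gamma (1 - \<alpha>) * (t - y) powr - \<alpha> * (\<alpha> * y powr (\<alpha> - 1)) * W \<omega>))"
  have [measurable]: "w \<in> borel_measurable (lborel \<Otimes>\<^sub>M M)" unfolding w_def by measurable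
  have w0: "0 \<le> w z" for z using W0 G1 \<alpha> by (auto simp: w_def split: prod.split)
  define K where "K = distr (density (lborel \<Otimes>\<^sub>M M) w) borel (\<lambda>(y, \<omega>). y powr \<alpha> * W \<omega>)"
  have Keq: "K = distr M borel (\<lambda>\<omega>. t powr \<alpha> * W \<omega>)"
    unfolding K_def w_def by (rule mittag_leffler_size_bias[OF \<alpha> t W])
  have intK: "integrable K G'"
    unfolding Keq
  proof (subst integrable_distr_eq)
    show "integrable M (\<lambda>\<omega>. G' (t powr \<alpha> * W \<omega>))"
    proof (rule integrable_const_bound[of _ C])
      show "AE \<omega> in M. norm (G' (t powr \<alpha> * W \<omega>)) \<le> C" unfolding G'_def by (auto intro!: G)
    qed simp
  qed auto
  hence intw: "integrable (lborel \<Otimes>\<^sub>M M) (\<lambda>z. w z * G' (case z of (y, \<omega>) \<Rightarrow> y powr \<alpha> * W \<omega>))"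
    unfolding K_def using w0 by (simp add: integrable_distr_eq integrable_density)
  have inner: "(\<integral>\<omega>. w (y, \<omega>) * G' (y powr \<alpha> * W \<omega>) \<partial>M)
     = 1 / Gamma (1 - \<alpha>) * (indicator {0<..<t} y * ((t - y) powr - \<alpha> * deriv f y))" for y
  proof (cases "y \<in> {0<..<t}")
    case True
    have "(\<integral>\<omega>. w (y, \<omega>) * G' (y powr \<alpha> * W \<omega>) \<partial>M)
      = (\<integral>\<omega>. (1 / Gamma (1 - \<alpha>) * (t - y) powr - \<alpha> * (\<alpha> * y powr (\<alpha> - 1))) * (W \<omega> * G (y powr \<alpha> * W \<omega>)) \<partial>M)"
      using True W0 by (intro Bochner_Integration.integral_cong) (auto simp: w_def G'_def max_def mult_ac)
    also have "\<dots> = (1 / Gamma (1 - \<alpha>) * (t - y) powr - \<alpha> * (\<alpha> * y powr (\<alpha> - 1))) * H' (y powr \<alpha>)"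
      unfolding H'_def by simp
    also have "\<dots> = 1 / Gamma (1 - \<alpha>) * (indicator {0<..<t} y * ((t - y) powr - \<alpha> * deriv f y))"
      using True DERIV_imp_deriv[OF der[of y]] by simp
    finally show ?thesis .
  qed (simp add: w_def)
  have int1: "integrable lborel (\<lambda>y. 1 / Gamma (1 - \<alpha>) * (indicator {0<..<t} y * ((t - y) powr - \<alpha> * deriv f y)))"
    using P.integrable_fst'[OF intw] by (simp add: inner)
  have "(\<integral>\<omega>. G (t powr \<alpha> * W \<omega>) \<partial>M) = (\<integral>x. G' x \<partial>K)"
    unfolding Keq using W0 by (subst integral_distr) (auto simp: G'_def max_def)
  also have "\<dots> = (\<integral>z. w z * G' (case z of (y, \<omega>) \<Rightarrow> y powr \<alpha> * W \<omega>) \<partial>(lborel \<Otimes>\<^sub>M M))"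
    unfolding K_def using w0 by (subst integral_distr) (auto simp: integral_density)
  also have "\<dots> = (\<integral>y. 1 / Gamma (1 - \<alpha>) * (indicator {0<..<t} y * ((t - y) powr - \<alpha> * deriv f y)) \<partial>lborel)"
    by (subst P.integral_fst'[OF intw, symmetric]) (simp add: inner)
  also have "\<dots> = 1 / Gamma (1 - \<alpha>) * (LINT y:{0<..<t}|lborel. (t - y) powr - \<alpha> * deriv f y)"
    by (simp add: set_lebesgue_integral_def)
  finally have val: "(\<integral>\<omega>. G (t powr \<alpha> * W \<omega>) \<partial>M) = 1 / Gamma (1 - \<alpha>) * (LINT y:{0<..<t}|lborel. (t - y) powr - \<alpha> * deriv f y)" .
  have "integrable lborel (\<lambda>y. Gamma (1 - \<alpha>) * (1 / Gamma (1 - \<alpha>) * (indicator {0<..<t} y * ((t - y) powr - \<alpha> * deriv f y))))"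
    by (rule integrable_mult_right[OF int1])
  hence "set_integrable lborel {0<..<t} (\<lambda>y. (t - y) powr - \<alpha> * deriv f y)"
    using G1 by (simp add: set_integrable_def)
  moreover have "f differentiable (at y)" if "y \<in> {0<..<t}" for y
    using der[of y] that real_differentiable_def by auto
  ultimately show ?thesis
    unfolding has_caputo_derivative_def using cont val by blast
qed

section \<open>Forward equations of jump processes with bounded rates\<close>

lemma nn_integral_countable_partition:
  assumes [measurable]: "Z \<in> M \<rightarrow>\<^sub>M count_space I" and I: "countable I" and [measurable]: "f \<in> borel_measurable M"
  shows "(\<integral>\<^sup>+\<omega>. f \<omega> \<partial>M) = (\<integral>\<^sup>+i. (\<integral>\<^sup>+\<omega>. f \<omega> * indicator {\<omega> \<in> space M. Z \<omega> = i} \<omega> \<partial>M) \<partial>count_space I)"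
proof -
  have "(\<integral>\<^sup>+\<omega>. f \<omega> \<partial>M) = (\<integral>\<^sup>+\<omega>. (\<integral>\<^sup>+i. f \<omega> * indicator {\<omega> \<in> space M. Z \<omega> = i} \<omega> \<partial>count_space I) \<partial>M)"
  proof (rule nn_integral_cong)
    fix \<omega> assume \<omega>: "\<omega> \<in> space M"
    hence ZI: "Z \<omega> \<in> I" using measurable_space[OF assms(1)] by simp
    have "(\<integral>\<^sup>+i. f \<omega> * indicator {\<omega> \<in> space M. Z \<omega> = i} \<omega> \<partial>count_space I)
        = (\<integral>\<^sup>+i. f \<omega> * indicator {Z \<omega>} i \<partial>count_space I)"
      using \<omega> by (intro nn_integral_cong) (auto simp: indicator_def)
    also have "\<dots> = f \<omega>" using ZI by (simp add: nn_integral_cmult_indicator)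
    finally show "f \<omega> = (\<integral>\<^sup>+i. f \<omega> * indicator {\<omega> \<in> space M. Z \<omega> = i} \<omega> \<partial>count_space I)" by simp
  qed
  also have "\<dots> = (\<integral>\<^sup>+i. (\<integral>\<^sup>+\<omega>. f \<omega> * indicator {\<omega> \<in> space M. Z \<omega> = i} \<omega> \<partial>M) \<partial>count_space I)"
    by (rule nn_integral_count_space_nn_integral[OF I]) measurable
  finally show ?thesis .
qed

text \<open>
  A uniform bound on the total rates makes the infinitesimal description uniform over the states, which
  allows to differentiate the state probabilities even though there may be infinitely many states.
\<close>

locale bounded_rate_jump_process = prob_space M
  for M :: "'w measure" +
  fixes S :: "'s set" and q :: "'s \<Rightarrow> 's \<Rightarrow> real" and X :: "real \<Rightarrow> 'w \<Rightarrow> 's" and C :: real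
  assumes jump: "markov_jump_process M S q X"
    and countable_S: "countable S"
    and out_rate_le: "\<And>x. x \<in> S \<Longrightarrow> (\<Sum>\<^sub>\<infinity>y\<in>S - {x}. q x y) \<le> C"
begin

lemmas markov_property = jump[unfolded markov_jump_process_def, THEN conjunct2, THEN conjunct2, THEN conjunct1]
lemmas homogeneous = jump[unfolded markov_jump_process_def, THEN conjunct2, THEN conjunct2, THEN conjunct2, THEN conjunct1]
lemmas jump_rates = jump[unfolded markov_jump_process_def, THEN conjunct2, THEN conjunct2, THEN conjunct2, THEN conjunct2, THEN conjunct1]
lemmas conservative = jump[unfolded markov_jump_process_def, THEN conjunct2, THEN conjunct2, THEN conjunct2, THEN conjunct2, THEN conjunct2]

abbreviation out_rate :: "'s \<Rightarrow> real" where
  "out_rate x \<equiv> (\<Sum>\<^sub>\<infinity>y\<in>S - {x}. q x y)"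

abbreviation law :: "'s \<Rightarrow> real \<Rightarrow> real" where
  "law x t \<equiv> \<P>(\<omega> in M. X t \<omega> = x)"

text \<open>
  Only for such states do the defining conditions say anything: a conditional probability given a
  null event carries no information.
\<close>

definition reachable :: "'s \<Rightarrow> bool" where
  "reachable x \<longleftrightarrow> (\<exists>u\<ge>0. 0 < law x u)"

text \<open>
  By homogeneity the conditioning time is irrelevant among those at which \<open>x\<close> has positive
  probability; for unreachable \<open>x\<close> the value is meaningless.
\<close>

definition transition :: "real \<Rightarrow> 's \<Rightarrow> 's \<Rightarrow> real" where
  "transition h x y = (let u = SOME u. 0 \<le> u \<and> 0 < law x u in \<P>(\<omega> in M. X (u + h) \<omega> = y \<bar> X u \<omega> = x))"

lemma measurable_X: "0 \<le> t \<Longrightarrow> X t \<in> M \<rightarrow>\<^sub>M count_space S"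
  using jump by (simp add: markov_jump_process_def)

lemma X_in_S: "0 \<le> t \<Longrightarrow> \<omega> \<in> space M \<Longrightarrow> X t \<omega> \<in> S"
  using measurable_space[OF measurable_X] by auto

lemma events_X: "0 \<le> t \<Longrightarrow> {\<omega> \<in> space M. X t \<omega> = x} \<in> events"
proof -
  assume t: "0 \<le> t"
  have "{\<omega> \<in> space M. X t \<omega> = x} = X t -` ({x} \<inter> S) \<inter> space M"
    using X_in_S[OF t] by auto
  thus ?thesis using measurable_sets[OF measurable_X[OF t], of "{x} \<inter> S"] by simp
qed

lemma pred_X[measurable (raw)]: "0 \<le> t \<Longrightarrow> Measurable.pred M (\<lambda>\<omega>. X t \<omega> = x)"
  using events_X by (simp add: pred_def)

lemma reachable_in_S: "reachable x \<Longrightarrow> x \<in> S"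
proof -
  assume "reachable x"
  then obtain u where u: "0 \<le> u" "0 < law x u" by (auto simp: reachable_def)
  hence "{\<omega> \<in> space M. X u \<omega> = x} \<noteq> {}" by (metis measure_empty less_irrefl)
  thus "x \<in> S" using X_in_S[OF u(1)] by auto
qed

lemma cond_prob_eq_trans:
  assumes "0 \<le> t" "0 \<le> h" "0 < law x t"
  shows "\<P>(\<omega> in M. X (t + h) \<omega> = y \<bar> X t \<omega> = x) = transition h x y"
proof -
  define u where "u = (SOME u. 0 \<le> u \<and> 0 < law x u)"
  have u: "0 \<le> u \<and> 0 < law x u"
    unfolding u_def by (rule someI[of _ t]) (use assms in auto)
  have "\<P>(\<omega> in M. X (t + h) \<omega> = y \<bar> X t \<omega> = x) = \<P>(\<omega> in M. X (u + h) \<omega> = y \<bar> X u \<omega> = x)"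
    by (rule homogeneous[rule_format]) (use assms u in auto)
  thus ?thesis by (simp add: transition_def u_def[symmetric] Let_def)
qed

text \<open>
  This holds for every state: if \<open>x\<close> has probability \<open>0\<close> at time \<open>t\<close>, both sides vanish.
\<close>

lemma joint_law:
  assumes "0 \<le> t" "0 \<le> h"
  shows "\<P>(\<omega> in M. X (t + h) \<omega> = y \<and> X t \<omega> = x) = law x t * transition h x y"
proof (cases "law x t = 0")
  case True
  have "\<P>(\<omega> in M. X (t + h) \<omega> = y \<and> X t \<omega> = x) \<le> law x t"
    using assms by (intro finite_measure_mono) auto
  thus ?thesis using True measure_nonneg[of M] by (simp add: antisym)
next
  case False
  hence "0 < law x t" by (simp add: zero_less_measure_iff)
  from cond_prob_eq_trans[OF assms this, of y] show ?thesis
    using False by (simp add: cond_prob_def divide_simps mult.commute)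
qed

lemma joint_law_stay:
  assumes "0 \<le> t" "0 \<le> h"
  shows "\<P>(\<omega> in M. X (t + h) \<omega> \<noteq> x \<and> X t \<omega> = x) = law x t * (1 - transition h x x)"
proof -
  have "\<P>(\<omega> in M. X (t + h) \<omega> \<noteq> x \<and> X t \<omega> = x)
      = measure M ({\<omega> \<in> space M. X t \<omega> = x} - {\<omega> \<in> space M. X (t + h) \<omega> = x \<and> X t \<omega> = x})"
    by (rule arg_cong[where f = "measure M"]) auto
  also have "\<dots> = law x t - law x t * transition h x x"
    using assms by (subst finite_measure_Diff) (auto simp: joint_law)
  finally show ?thesis by (simp add: algebra_simps)
qed

lemma transition_bounds:
  assumes "reachable x" "0 \<le> h"
  shows "0 \<le> transition h x y" "transition h x y \<le> 1" "x \<noteq> y \<Longrightarrow> transition h x y \<le> 1 - transition h x x"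
proof -
  obtain u where u: "0 \<le> u" "0 < law x u" using assms(1) by (auto simp: reachable_def)
  have "0 \<le> law x u * transition h x y" unfolding joint_law[OF u(1) assms(2), symmetric] by simp
  thus "0 \<le> transition h x y" using u by (simp add: zero_le_mult_iff)
  have "law x u * transition h x y \<le> law x u"
    unfolding joint_law[OF u(1) assms(2), symmetric] using u assms by (intro finite_measure_mono) auto
  thus "transition h x y \<le> 1" using u by simp
  assume "x \<noteq> y"
  hence "law x u * transition h x y \<le> law x u * (1 - transition h x x)"
    unfolding joint_law[OF u(1) assms(2), symmetric] joint_law_stay[OF u(1) assms(2), symmetric]
    using u assms by (intro finite_measure_mono) auto
  thus "transition h x y \<le> 1 - transition h x x" using u by simp
qed

text \<open>
  One way of being in \<open>x\<close> after time \<open>s + h\<close> is to be there after time \<open>s\<close> as well.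
\<close>

lemma transition_super_multiplicative:
  assumes "reachable x" "0 < s" "0 \<le> h"
  shows "transition s x x * transition h x x \<le> transition (s + h) x x"
proof -
  obtain u where u: "0 \<le> u" "0 < law x u" using assms(1) by (auto simp: reachable_def)
  have "law x u * (transition s x x * transition h x x) \<le> law x u * transition (s + h) x x"
  proof (cases "\<P>(\<omega> in M. X (u + s) \<omega> = x \<and> X u \<omega> = x) = 0")
    case True
    thus ?thesis using joint_law[of u s x x] u assms transition_bounds[of x "s + h" x] by simp
  next
    case False
    hence pos: "0 < \<P>(\<omega> in M. X (u + s) \<omega> = x \<and> X u \<omega> = x)" by (simp add: zero_less_measure_iff)
    also have "\<dots> \<le> law x (u + s)" using u assms by (intro finite_measure_mono) auto
    finally have pos': "0 < law x (u + s)" .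
    from markov_property[rule_format, of "{u}" "u + s" h x "\<lambda>_. x" x]
    have "\<P>(\<omega> in M. X (u + s + h) \<omega> = x \<bar> X (u + s) \<omega> = x \<and> X u \<omega> = x) = \<P>(\<omega> in M. X (u + s + h) \<omega> = x \<bar> X (u + s) \<omega> = x)"
      using u assms pos by simp
    also have "\<dots> = transition h x x" using cond_prob_eq_trans[OF _ assms(3) pos', of x] u assms by simp
    finally have "\<P>(\<omega> in M. X (u + s + h) \<omega> = x \<and> X (u + s) \<omega> = x \<and> X u \<omega> = x)
        = transition h x x * \<P>(\<omega> in M. X (u + s) \<omega> = x \<and> X u \<omega> = x)"
      using pos by (simp add: cond_prob_def nonzero_divide_eq_eq)
    hence "\<P>(\<omega> in M. X (u + s + h) \<omega> = x \<and> X (u + s) \<omega> = x \<and> X u \<omega> = x) = law x u * transition s x x * transition h x x"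
      using joint_law[of u s x x] u assms by simp
    moreover have "\<P>(\<omega> in M. X (u + s + h) \<omega> = x \<and> X (u + s) \<omega> = x \<and> X u \<omega> = x) \<le> \<P>(\<omega> in M. X (u + (s + h)) \<omega> = x \<and> X u \<omega> = x)"
      using u assms by (intro finite_measure_mono) (auto simp: add.assoc)
    ultimately show ?thesis using joint_law[of u "s + h" x x] u assms by (simp add: mult.assoc)
  qed
  thus ?thesis using u by simp
qed

lemma transition_rates:
  assumes "reachable x"
  shows "((\<lambda>h. (1 - transition h x x) / h) \<longlongrightarrow> out_rate x) (at_right 0)"
    and "y \<in> S \<Longrightarrow> x \<noteq> y \<Longrightarrow> ((\<lambda>h. transition h x y / h) \<longlongrightarrow> q x y) (at_right 0)"
proof -
  obtain u where u: "0 \<le> u" "0 < law x u" using assms(1) by (auto simp: reachable_def)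
  have x: "x \<in> S" by (rule reachable_in_S[OF assms])
  have pos: "\<forall>\<^sub>F h in at_right 0. (0::real) < h" by (auto simp: eventually_at_right_less)
  have leave: "((\<lambda>h. \<P>(\<omega> in M. X (u + h) \<omega> \<noteq> x \<bar> X u \<omega> = x) / h) \<longlongrightarrow> out_rate x) (at_right 0)"
    by (rule conservative[rule_format]) (use u x in auto)
  show "((\<lambda>h. (1 - transition h x x) / h) \<longlongrightarrow> out_rate x) (at_right 0)"
  proof (rule Lim_transform_eventually[OF leave])
    show "\<forall>\<^sub>F h in at_right 0. \<P>(\<omega> in M. X (u + h) \<omega> \<noteq> x \<bar> X u \<omega> = x) / h = (1 - transition h x x) / h"
      using pos
    proof eventually_elim
      case (elim h)
      show ?case using joint_law_stay[of u h x] u elim by (simp add: cond_prob_def)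
    qed
  qed
  assume y: "y \<in> S" "x \<noteq> y"
  have jmp: "((\<lambda>h. \<P>(\<omega> in M. X (u + h) \<omega> = y \<bar> X u \<omega> = x) / h) \<longlongrightarrow> q x y) (at_right 0)"
    by (rule jump_rates[rule_format]) (use u x y in auto)
  show "((\<lambda>h. transition h x y / h) \<longlongrightarrow> q x y) (at_right 0)"
  proof (rule Lim_transform_eventually[OF jmp])
    show "\<forall>\<^sub>F h in at_right 0. \<P>(\<omega> in M. X (u + h) \<omega> = y \<bar> X u \<omega> = x) / h = transition h x y / h"
      using pos by eventually_elim (use u cond_prob_eq_trans in auto)
  qed
qed

text \<open>
  By \<open>transition_super_multiplicative\<close> the probability \<open>1 - transition h x x\<close> of not being in \<open>x\<close> after
  time \<open>h\<close> is subadditive in \<open>h\<close>, hence bounded by its slope at \<open>0\<close>, the rate out of \<open>x\<close>.  So the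
  pointwise limits in the definition of a jump process become a bound uniform in \<open>x\<close>.
\<close>

lemma leave_prob_le:
  assumes x: "reachable x" and h: "0 < h"
  shows "1 - transition h x x \<le> C * h"
proof -
  have mult: "1 - transition (real (Suc n) * s) x x \<le> real (Suc n) * (1 - transition s x x)" if s: "0 < s" for n s
  proof (induction n)
    case (Suc n)
    define a b where "a = transition s x x" and "b = transition (real (Suc n) * s) x x"
    have ab: "0 \<le> a" "a \<le> 1" "0 \<le> b" "b \<le> 1"
      unfolding a_def b_def using transition_bounds[OF x] s by auto
    have "a * b \<le> transition (s + real (Suc n) * s) x x"
      unfolding a_def b_def by (rule transition_super_multiplicative[OF x s]) (use s in auto)
    also have "s + real (Suc n) * s = real (Suc (Suc n)) * s" by (simp add: algebra_simps)
    finally have "1 - transition (real (Suc (Suc n)) * s) x x \<le> 1 - a * b" by simp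
    also have "\<dots> \<le> (1 - a) + (1 - b)"
      using mult_nonneg_nonneg[of "1 - a" "1 - b"] ab by (simp add: algebra_simps)
    also have "\<dots> \<le> real (Suc (Suc n)) * (1 - a)" using Suc by (simp add: a_def b_def algebra_simps)
    finally show ?case by (simp add: a_def)
  qed simp
  have "(\<lambda>n. (1 - transition (h / real (Suc n)) x x) / (h / real (Suc n))) \<longlonglongrightarrow> out_rate x"
  proof (rule filterlim_compose[OF transition_rates(1)[OF x]])
    have "(\<lambda>n. h / real (Suc n)) \<longlonglongrightarrow> 0" by real_asymp
    thus "filterlim (\<lambda>n. h / real (Suc n)) (at_right 0) sequentially"
      using h by (auto simp: filterlim_at intro!: always_eventually)
  qed
  moreover have "(1 - transition h x x) / h \<le> (1 - transition (h / real (Suc n)) x x) / (h / real (Suc n))" for n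
    using mult[of "h / real (Suc n)" n] h by (simp add: divide_simps mult_ac)
  ultimately have "(1 - transition h x x) / h \<le> out_rate x"
    by (intro LIMSEQ_le_const) auto
  also have "\<dots> \<le> C" by (rule out_rate_le[OF reachable_in_S[OF x]])
  finally show ?thesis using h by (simp add: divide_simps)
qed

lemma C_nonneg: "0 \<le> C"
proof -
  obtain \<omega> where "\<omega> \<in> space M" using not_empty by auto
  have "\<exists>x. reachable x"
  proof (rule ccontr)
    assume "\<nexists>x. reachable x"
    hence "law x 0 = 0" for x using measure_nonneg[of M] by (force simp: reachable_def order.order_iff_strict)
    hence "\<integral>\<^sup>+\<omega>. 1 \<partial>M = (0::ennreal)"
      by (subst nn_integral_countable_partition[OF measurable_X[of 0] countable_S])
         (auto simp: emeasure_eq_measure events_X)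
    thus False by (simp add: emeasure_space_1)
  qed
  then obtain x where x: "reachable x" by blast
  show ?thesis using leave_prob_le[OF x, of 1] transition_bounds(2)[OF x, of 1 x] by simp
qed

lemma AE_reachable:
  assumes "0 \<le> t"
  shows "AE \<omega> in M. reachable (X t \<omega>)"
proof -
  have "AE \<omega> in M. \<forall>x\<in>S. X t \<omega> = x \<longrightarrow> 0 < law x t"
  proof (subst AE_ball_countable[OF countable_S], rule ballI)
    fix x
    show "AE \<omega> in M. X t \<omega> = x \<longrightarrow> 0 < law x t"
    proof (cases "law x t = 0")
      case True
      thus ?thesis using events_X[OF assms, of x]
        by (intro AE_I'[of "{\<omega> \<in> space M. X t \<omega> = x}"]) (auto simp: null_sets_def emeasure_eq_measure)
    qed (auto simp: zero_less_measure_iff)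
  qed
  thus ?thesis
    by (rule AE_mp) (use X_in_S[OF assms] assms in \<open>auto simp: reachable_def\<close>)
qed

text \<open>
  Average \<open>leave_prob_le\<close> over the state at time \<open>s\<close>.
\<close>

lemma prob_change_le:
  assumes s: "0 \<le> s" and h: "0 < h"
  shows "{\<omega> \<in> space M. X (s + h) \<omega> \<noteq> X s \<omega>} \<in> events" "\<P>(\<omega> in M. X (s + h) \<omega> \<noteq> X s \<omega>) \<le> C * h"
proof -
  have "{\<omega> \<in> space M. X (s + h) \<omega> \<noteq> X s \<omega>} = (\<Union>x\<in>S. {\<omega> \<in> space M. X (s + h) \<omega> \<noteq> x \<and> X s \<omega> = x})"
    using X_in_S[OF s] by auto
  also have "\<dots> \<in> events" using s h by (intro sets.countable_UN'[OF countable_S]) auto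
  finally show ev: "{\<omega> \<in> space M. X (s + h) \<omega> \<noteq> X s \<omega>} \<in> events" .
  have "ennreal (\<P>(\<omega> in M. X (s + h) \<omega> \<noteq> X s \<omega>)) = (\<integral>\<^sup>+\<omega>. indicator {\<omega> \<in> space M. X (s + h) \<omega> \<noteq> X s \<omega>} \<omega> \<partial>M)"
    using ev by (simp add: emeasure_eq_measure)
  also have "\<dots> = (\<integral>\<^sup>+x. (\<integral>\<^sup>+\<omega>. indicator {\<omega> \<in> space M. X (s + h) \<omega> \<noteq> X s \<omega>} \<omega> * indicator {\<omega> \<in> space M. X s \<omega> = x} \<omega> \<partial>M) \<partial>count_space S)"
    by (rule nn_integral_countable_partition[OF measurable_X[OF s] countable_S]) (use ev in auto)
  also have "\<dots> = (\<integral>\<^sup>+x. ennreal (\<P>(\<omega> in M. X (s + h) \<omega> \<noteq> x \<and> X s \<omega> = x)) \<partial>count_space S)"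
  proof (rule nn_integral_cong)
    fix x
    have "(\<integral>\<^sup>+\<omega>. indicator {\<omega> \<in> space M. X (s + h) \<omega> \<noteq> X s \<omega>} \<omega> * indicator {\<omega> \<in> space M. X s \<omega> = x} \<omega> \<partial>M)
      = (\<integral>\<^sup>+\<omega>. indicator {\<omega> \<in> space M. X (s + h) \<omega> \<noteq> x \<and> X s \<omega> = x} \<omega> \<partial>M)"
      by (intro nn_integral_cong) (auto simp: indicator_def)
    thus "(\<integral>\<^sup>+\<omega>. indicator {\<omega> \<in> space M. X (s + h) \<omega> \<noteq> X s \<omega>} \<omega> * indicator {\<omega> \<in> space M. X s \<omega> = x} \<omega> \<partial>M)
      = ennreal (\<P>(\<omega> in M. X (s + h) \<omega> \<noteq> x \<and> X s \<omega> = x))"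
      using s h by (simp add: emeasure_eq_measure)
  qed
  also have "\<dots> \<le> (\<integral>\<^sup>+x. ennreal (C * h) * (\<integral>\<^sup>+\<omega>. 1 * indicator {\<omega> \<in> space M. X s \<omega> = x} \<omega> \<partial>M) \<partial>count_space S)"
  proof (rule nn_integral_mono)
    fix x
    have "\<P>(\<omega> in M. X (s + h) \<omega> \<noteq> x \<and> X s \<omega> = x) \<le> C * h * law x s"
    proof (cases "law x s = 0")
      case False
      hence "reachable x" using s by (auto simp: reachable_def zero_less_measure_iff)
      then show ?thesis
        using joint_law_stay[of s h x] s h
          mult_right_mono[OF leave_prob_le[OF _ h, of x], of "law x s"] by (simp add: mult.commute)
    qed (use joint_law_stay[of s h x] s h in auto)
    hence "ennreal (\<P>(\<omega> in M. X (s + h) \<omega> \<noteq> x \<and> X s \<omega> = x)) \<le> ennreal (C * h * law x s)"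
      by (rule ennreal_leI)
    also have "\<dots> = ennreal (C * h) * (\<integral>\<^sup>+\<omega>. 1 * indicator {\<omega> \<in> space M. X s \<omega> = x} \<omega> \<partial>M)"
      using s events_X[OF s, of x] C_nonneg h by (simp add: ennreal_mult emeasure_eq_measure)
    finally show "ennreal (\<P>(\<omega> in M. X (s + h) \<omega> \<noteq> x \<and> X s \<omega> = x)) \<le> ennreal (C * h) * (\<integral>\<^sup>+\<omega>. 1 * indicator {\<omega> \<in> space M. X s \<omega> = x} \<omega> \<partial>M)" .
  qed
  also have "\<dots> = ennreal (C * h) * (\<integral>\<^sup>+x. (\<integral>\<^sup>+\<omega>. 1 * indicator {\<omega> \<in> space M. X s \<omega> = x} \<omega> \<partial>M) \<partial>count_space S)"
    by (rule nn_integral_cmult) simp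
  also have "\<dots> = ennreal (C * h)"
    by (subst nn_integral_countable_partition[OF measurable_X[OF s] countable_S, symmetric]) (auto simp: emeasure_space_1)
  finally show "\<P>(\<omega> in M. X (s + h) \<omega> \<noteq> X s \<omega>) \<le> C * h"
    using C_nonneg h by (subst (asm) ennreal_le_iff) auto
qed

text \<open>
  The difference quotient of the transition probabilities at \<open>0\<close>.  It is set to \<open>0\<close> at unreachable
  states, so that the bound of \<open>incr_bound\<close> holds everywhere.
\<close>

definition incr :: "'s \<Rightarrow> real \<Rightarrow> 's \<Rightarrow> real" where
  "incr y h x = (if reachable x then (transition h x y - (if x = y then 1 else 0)) / h else 0)"

lemma incr_bound: "0 < h \<Longrightarrow> \<bar>incr y h x\<bar> \<le> C"
  using leave_prob_le[of x h] transition_bounds[of x h y] C_nonneg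
  by (auto simp: incr_def divide_simps)

lemma measurable_comp_X: "0 \<le> t \<Longrightarrow> (\<lambda>\<omega>. (\<phi> :: 's \<Rightarrow> real) (X t \<omega>)) \<in> borel_measurable M"
  by (rule measurable_compose[OF measurable_X]) auto

text \<open>
  Total probability: average the one-step increments over the state at time \<open>s\<close>.
\<close>

lemma law_increment:
  assumes s: "0 \<le> s" and h: "0 < h"
  shows "(law y (s + h) - law y s) / h = expectation (\<lambda>\<omega>. incr y h (X s \<omega>))"
proof -
  define \<phi> where "\<phi> x = (if reachable x then transition h x y else 0)" for x
  have \<phi>: "0 \<le> \<phi> x" "\<phi> x \<le> 1" for x using transition_bounds[of x h y] h by (auto simp: \<phi>_def)
  have int\<phi>: "integrable M (\<lambda>\<omega>. \<phi> (X s \<omega>))"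
    by (rule integrable_const_bound[of _ 1]) (use \<phi> measurable_comp_X[OF s] in auto)
  have "(\<integral>\<^sup>+\<omega>. ennreal (\<phi> (X s \<omega>)) \<partial>M)
      = (\<integral>\<^sup>+x. (\<integral>\<^sup>+\<omega>. ennreal (\<phi> (X s \<omega>)) * indicator {\<omega> \<in> space M. X s \<omega> = x} \<omega> \<partial>M) \<partial>count_space S)"
    by (rule nn_integral_countable_partition[OF measurable_X[OF s] countable_S]) (use measurable_comp_X[OF s] in auto)
  also have "\<dots> = (\<integral>\<^sup>+x. (\<integral>\<^sup>+\<omega>. indicator {\<omega> \<in> space M. X (s + h) \<omega> = y} \<omega> * indicator {\<omega> \<in> space M. X s \<omega> = x} \<omega> \<partial>M) \<partial>count_space S)"
  proof (rule nn_integral_cong)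
    fix x
    have "(\<integral>\<^sup>+\<omega>. ennreal (\<phi> (X s \<omega>)) * indicator {\<omega> \<in> space M. X s \<omega> = x} \<omega> \<partial>M)
      = (\<integral>\<^sup>+\<omega>. ennreal (\<phi> x) * indicator {\<omega> \<in> space M. X s \<omega> = x} \<omega> \<partial>M)"
      by (intro nn_integral_cong) (auto simp: indicator_def)
    also have "\<dots> = ennreal (\<phi> x * law x s)"
      using events_X[OF s, of x] \<phi> by (simp add: nn_integral_cmult_indicator emeasure_eq_measure ennreal_mult)
    also have "\<phi> x * law x s = \<P>(\<omega> in M. X (s + h) \<omega> = y \<and> X s \<omega> = x)"
    proof (cases "reachable x")
      case False
      hence "law x s = 0" using s by (auto simp: reachable_def zero_less_measure_iff)
      thus ?thesis using joint_law[of s h y x] s h by simp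
    qed (use joint_law[of s h y x] s h in \<open>simp add: \<phi>_def mult.commute\<close>)
    also have "ennreal \<dots> = (\<integral>\<^sup>+\<omega>. indicator {\<omega> \<in> space M. X (s + h) \<omega> = y \<and> X s \<omega> = x} \<omega> \<partial>M)"
      using s h by (simp add: emeasure_eq_measure)
    also have "\<dots> = (\<integral>\<^sup>+\<omega>. indicator {\<omega> \<in> space M. X (s + h) \<omega> = y} \<omega> * indicator {\<omega> \<in> space M. X s \<omega> = x} \<omega> \<partial>M)"
      by (intro nn_integral_cong) (auto simp: indicator_def)
    finally show "(\<integral>\<^sup>+\<omega>. ennreal (\<phi> (X s \<omega>)) * indicator {\<omega> \<in> space M. X s \<omega> = x} \<omega> \<partial>M)
      = (\<integral>\<^sup>+\<omega>. indicator {\<omega> \<in> space M. X (s + h) \<omega> = y} \<omega> * indicator {\<omega> \<in> space M. X s \<omega> = x} \<omega> \<partial>M)" .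
  qed
  also have "\<dots> = (\<integral>\<^sup>+\<omega>. indicator {\<omega> \<in> space M. X (s + h) \<omega> = y} \<omega> \<partial>M)"
    by (rule nn_integral_countable_partition[OF measurable_X[OF s] countable_S, symmetric]) (use s h in auto)
  also have "\<dots> = ennreal (law y (s + h))"
    using s h by (simp add: emeasure_eq_measure events_X)
  finally have E\<phi>: "expectation (\<lambda>\<omega>. \<phi> (X s \<omega>)) = law y (s + h)"
    using \<phi> by (subst (asm) nn_integral_eq_integral[OF int\<phi>]) auto
  have "expectation (\<lambda>\<omega>. incr y h (X s \<omega>)) = expectation (\<lambda>\<omega>. (\<phi> (X s \<omega>) - indicator {\<omega> \<in> space M. X s \<omega> = y} \<omega>) / h)"
  proof (rule integral_cong_AE)
    show "AE \<omega> in M. incr y h (X s \<omega>) = (\<phi> (X s \<omega>) - indicator {\<omega> \<in> space M. X s \<omega> = y} \<omega>) / h"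
      using AE_reachable[OF s] by (rule AE_mp) (auto simp: incr_def \<phi>_def)
  qed (use measurable_comp_X[OF s] events_X[OF s] in auto)
  also have "\<dots> = (law y (s + h) - law y s) / h"
    using int\<phi> events_X[OF s, of y] by (simp add: E\<phi> emeasure_eq_measure)
  finally show ?thesis by simp
qed

text \<open>
  By \<open>law_increment\<close>, the difference quotient between \<open>r\<close> and \<open>t\<close> is an expectation of the bounded
  functions \<open>incr\<close> evaluated at \<open>X (min r t)\<close>.  For \<open>r > t\<close> dominated convergence applies at once.  For
  \<open>r < t\<close> the state \<open>X r\<close> is first replaced by \<open>X t\<close>, at a cost controlled by \<open>prob_change_le\<close>.
\<close>

lemma law_has_derivative:
  assumes y: "y \<in> S" and t: "0 \<le> t"
  shows "(law y has_real_derivative expectation (\<lambda>\<omega>. if X t \<omega> = y then - out_rate y else q (X t \<omega>) y))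
           (at t within {0..})"
proof -
  define g where "g x = (if x = y then - out_rate y else q x y)" for x
  have lim: "((\<lambda>h. incr y h x) \<longlongrightarrow> g x) (at_right 0)" if "reachable x" for x
  proof (cases "x = y")
    case True
    have "((\<lambda>h. - ((1 - transition h y y) / h)) \<longlongrightarrow> - out_rate y) (at_right 0)"
      using transition_rates(1)[of y] that True by (intro tendsto_minus) auto
    thus ?thesis using that True by (simp add: incr_def g_def minus_divide_left)
  next
    case False
    thus ?thesis using transition_rates(2)[OF that y] that by (simp add: incr_def g_def)
  qed
  have "(law y has_real_derivative expectation (\<lambda>\<omega>. g (X t \<omega>))) (at t within {0..})"
    unfolding has_field_derivative_iff tendsto_at_iff_sequentially comp_def
  proof (intro allI impI)
    fix r :: "nat \<Rightarrow> real" assume r: "\<forall>i. r i \<in> {0..} - {t}" "r \<longlonglongrightarrow> t"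
    define s h where "s i = min (r i) t" and "h i = \<bar>r i - t\<bar>" for i
    have s: "0 \<le> s i" and h: "0 < h i" for i using r t by (auto simp: s_def h_def)
    have h0: "h \<longlonglongrightarrow> 0" unfolding h_def using r(2) by (auto intro!: tendsto_eq_intros)
    have quot: "(law y (r i) - law y t) / (r i - t) = expectation (\<lambda>\<omega>. incr y (h i) (X (s i) \<omega>))" for i
    proof (cases "t < r i")
      case True
      thus ?thesis using law_increment[OF s[of i] h[of i], of y] by (simp add: s_def h_def min_def)
    next
      case False
      hence "r i < t" using r(1) by (metis DiffE insertI1 linorder_neqE_linordered_idom)
      thus ?thesis using law_increment[OF s[of i] h[of i], of y]
        by (simp add: s_def h_def min_def) (simp add: divide_simps, simp add: algebra_simps)
    qed
    have int: "integrable M (\<lambda>\<omega>. incr y (h i) (X u \<omega>))" if "0 \<le> u" for u i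
      by (rule integrable_const_bound[of _ C]) (use incr_bound[OF h] measurable_comp_X[OF that] in auto)
    have close: "\<bar>expectation (\<lambda>\<omega>. incr y (h i) (X (s i) \<omega>)) - expectation (\<lambda>\<omega>. incr y (h i) (X t \<omega>))\<bar> \<le> 2 * C * (C * h i)" for i
    proof (cases "t \<le> r i")
      case True
      thus ?thesis using C_nonneg h[of i] by (simp add: s_def)
    next
      case False
      hence st: "s i + h i = t" by (simp add: s_def h_def)
      have ev: "{\<omega> \<in> space M. X t \<omega> \<noteq> X (s i) \<omega>} \<in> events" "\<P>(\<omega> in M. X t \<omega> \<noteq> X (s i) \<omega>) \<le> C * h i"
        using prob_change_le[OF s[of i] h[of i]] by (simp_all add: st)
      have "\<bar>expectation (\<lambda>\<omega>. incr y (h i) (X (s i) \<omega>)) - expectation (\<lambda>\<omega>. incr y (h i) (X t \<omega>))\<bar>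
        = \<bar>expectation (\<lambda>\<omega>. incr y (h i) (X (s i) \<omega>) - incr y (h i) (X t \<omega>))\<bar>"
        using int s t by simp
      also have "\<dots> \<le> expectation (\<lambda>\<omega>. \<bar>incr y (h i) (X (s i) \<omega>) - incr y (h i) (X t \<omega>)\<bar>)"
        by (rule integral_abs_bound)
      also have "\<dots> \<le> expectation (\<lambda>\<omega>. 2 * C * indicator {\<omega> \<in> space M. X t \<omega> \<noteq> X (s i) \<omega>} \<omega>)"
      proof (rule integral_mono)
        show "integrable M (\<lambda>\<omega>. 2 * C * indicator {\<omega> \<in> space M. X t \<omega> \<noteq> X (s i) \<omega>} \<omega>)"
          using ev by (simp add: emeasure_eq_measure)
        show "\<bar>incr y (h i) (X (s i) \<omega>) - incr y (h i) (X t \<omega>)\<bar> \<le> 2 * C * indicator {\<omega> \<in> space M. X t \<omega> \<noteq> X (s i) \<omega>} \<omega>"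
          if "\<omega> \<in> space M" for \<omega>
          using that incr_bound[OF h[of i], of y "X t \<omega>"] incr_bound[OF h[of i], of y "X (s i) \<omega>"]
          by (auto simp: indicator_def)
      qed (use int s t in auto)
      also have "\<dots> = 2 * C * \<P>(\<omega> in M. X t \<omega> \<noteq> X (s i) \<omega>)" using ev by simp
      also have "\<dots> \<le> 2 * C * (C * h i)" using ev C_nonneg by (intro mult_left_mono) auto
      finally show ?thesis .
    qed
    have main: "(\<lambda>i. expectation (\<lambda>\<omega>. incr y (h i) (X t \<omega>))) \<longlonglongrightarrow> expectation (\<lambda>\<omega>. g (X t \<omega>))"
    proof (rule integral_dominated_convergence[where w = "\<lambda>_. C"])
      show "AE \<omega> in M. (\<lambda>i. incr y (h i) (X t \<omega>)) \<longlonglongrightarrow> g (X t \<omega>)"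
        using AE_reachable[OF t]
      proof eventually_elim
        case (elim \<omega>)
        show ?case
          by (rule filterlim_compose[OF lim[OF elim]])
             (use h less_imp_neq[OF h] h0 in \<open>auto simp: filterlim_at intro!: always_eventually\<close>)
      qed
    qed (use measurable_comp_X[OF t] incr_bound[OF h] in auto)
    have "(\<lambda>i. expectation (\<lambda>\<omega>. incr y (h i) (X (s i) \<omega>)) - expectation (\<lambda>\<omega>. incr y (h i) (X t \<omega>))) \<longlonglongrightarrow> 0"
    proof (rule Lim_null_comparison)
      show "(\<lambda>i. 2 * C * (C * h i)) \<longlonglongrightarrow> 0" using h0 by (auto intro!: tendsto_eq_intros)
    qed (use close in auto)
    from tendsto_add[OF this main]
    show "(\<lambda>i. (law y (r i) - law y t) / (r i - t)) \<longlonglongrightarrow> expectation (\<lambda>\<omega>. g (X t \<omega>))"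
      by (simp add: quot)
  qed
  thus ?thesis by (simp add: g_def)
qed

text \<open>
  The set \<open>A\<close> contains the possible predecessors of \<open>y\<close>.  Elements of \<open>A\<close> outside \<open>S\<close> do no harm, as
  their probability is \<open>0\<close>.
\<close>

proposition forward_equation:
  assumes y: "y \<in> S" and t: "0 \<le> t"
    and A: "finite A" "y \<notin> A" "\<And>x. x \<in> S \<Longrightarrow> x \<notin> A \<Longrightarrow> x \<noteq> y \<Longrightarrow> q x y = 0"
  shows "(law y has_real_derivative (\<Sum>x\<in>A. q x y * law x t) - out_rate y * law y t) (at t within {0..})"
proof -
  have "expectation (\<lambda>\<omega>. if X t \<omega> = y then - out_rate y else q (X t \<omega>) y)
    = expectation (\<lambda>\<omega>. (\<Sum>x\<in>A. q x y * indicator {\<omega> \<in> space M. X t \<omega> = x} \<omega>) - out_rate y * indicator {\<omega> \<in> space M. X t \<omega> = y} \<omega>)"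
  proof (rule Bochner_Integration.integral_cong[OF refl])
    fix \<omega> assume \<omega>: "\<omega> \<in> space M"
    have "(\<Sum>x\<in>A. q x y * indicator {\<omega> \<in> space M. X t \<omega> = x} \<omega>) = (\<Sum>x\<in>A. if X t \<omega> = x then q x y else 0)"
      using \<omega> by (intro sum.cong) (auto simp: indicator_def)
    also have "\<dots> = (if X t \<omega> \<in> A then q (X t \<omega>) y else 0)" using A(1) by simp
    finally show "(if X t \<omega> = y then - out_rate y else q (X t \<omega>) y)
      = (\<Sum>x\<in>A. q x y * indicator {\<omega> \<in> space M. X t \<omega> = x} \<omega>) - out_rate y * indicator {\<omega> \<in> space M. X t \<omega> = y} \<omega>"
      using A(2) A(3)[OF X_in_S[OF t \<omega>]] \<omega> by (auto simp: indicator_def)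
  qed
  also have "\<dots> = (\<Sum>x\<in>A. q x y * law x t) - out_rate y * law y t"
  proof -
    have ind: "has_bochner_integral M (\<lambda>\<omega>. c * indicator {\<omega> \<in> space M. X t \<omega> = x} \<omega>) (c * law x t)" for c x
      using events_X[OF t, of x] by (intro has_bochner_integral_mult_right has_bochner_integral_real_indicator) (auto simp: emeasure_eq_measure)
    show ?thesis
      by (rule has_bochner_integral_integral_eq, intro has_bochner_integral_diff has_bochner_integral_sum ind)
  qed
  finally show ?thesis using law_has_derivative[OF y t] by simp
qed

end

section \<open>Time change by the inverse stable subordinator\<close>

text \<open>
  Events of the form \<open>{X r \<in> a}\<close> and \<open>{Y t \<in> b}\<close> are cylinders, hence belong to the two generated
  sigma-algebras.  Independence of these includes that they consist of measurable events.
\<close>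

lemma (in prob_space) indep_processesD:
  assumes indep: "indep_processes M A X B Y" and r: "0 \<le> r" and t: "0 \<le> t"
    and X: "\<And>r. 0 \<le> r \<Longrightarrow> X r \<in> space M \<rightarrow> space A"
    and Y: "\<And>t. 0 \<le> t \<Longrightarrow> Y t \<in> space M \<rightarrow> space B"
    and a: "a \<in> sets A" and b: "b \<in> sets B"
  shows "{\<omega> \<in> space M. Y t \<omega> \<in> b} \<in> events"
    and "\<P>(\<omega> in M. X r \<omega> \<in> a \<and> Y t \<omega> \<in> b) = \<P>(\<omega> in M. X r \<omega> \<in> a) * \<P>(\<omega> in M. Y t \<omega> \<in> b)"
proof -
  let ?VX = "vimage_algebra (space M) (\<lambda>\<omega>. \<lambda>t\<in>{0..}. X t \<omega>) (\<Pi>\<^sub>M t\<in>{0..}. A)"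
  let ?VY = "vimage_algebra (space M) (\<lambda>\<omega>. \<lambda>t\<in>{0..}. Y t \<omega>) (\<Pi>\<^sub>M t\<in>{0..}. B)"
  have ind: "indep_set (sets ?VX) (sets ?VY)" using indep by (simp add: indep_processes_def)
  have "(\<lambda>f. f r) -` a \<inter> space (\<Pi>\<^sub>M t\<in>{0::real..}. A) \<in> sets (\<Pi>\<^sub>M t\<in>{0..}. A)"
    by (rule measurable_sets[OF measurable_component_singleton[where M = "\<lambda>_. A"] a]) (use r in simp)
  from in_vimage_algebra[OF this, of "\<lambda>\<omega>. \<lambda>t\<in>{0..}. X t \<omega>" "space M"]
  have "(\<lambda>\<omega>. \<lambda>t\<in>{0..}. X t \<omega>) -` ((\<lambda>f. f r) -` a \<inter> space (\<Pi>\<^sub>M t\<in>{0..}. A)) \<inter> space M \<in> sets ?VX" .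
  also have "(\<lambda>\<omega>. \<lambda>t\<in>{0..}. X t \<omega>) -` ((\<lambda>f. f r) -` a \<inter> space (\<Pi>\<^sub>M t\<in>{0..}. A)) \<inter> space M = {\<omega> \<in> space M. X r \<omega> \<in> a}"
    using X r by (auto simp: space_PiM PiE_def Pi_def)
  finally have a': "{\<omega> \<in> space M. X r \<omega> \<in> a} \<in> sets ?VX" .
  have "(\<lambda>f. f t) -` b \<inter> space (\<Pi>\<^sub>M t\<in>{0::real..}. B) \<in> sets (\<Pi>\<^sub>M t\<in>{0..}. B)"
    by (rule measurable_sets[OF measurable_component_singleton[where M = "\<lambda>_. B"] b]) (use t in simp)
  from in_vimage_algebra[OF this, of "\<lambda>\<omega>. \<lambda>t\<in>{0..}. Y t \<omega>" "space M"]
  have "(\<lambda>\<omega>. \<lambda>t\<in>{0..}. Y t \<omega>) -` ((\<lambda>f. f t) -` b \<inter> space (\<Pi>\<^sub>M t\<in>{0..}. B)) \<inter> space M \<in> sets ?VY" .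
  also have "(\<lambda>\<omega>. \<lambda>t\<in>{0..}. Y t \<omega>) -` ((\<lambda>f. f t) -` b \<inter> space (\<Pi>\<^sub>M t\<in>{0..}. B)) \<inter> space M = {\<omega> \<in> space M. Y t \<omega> \<in> b}"
    using Y t by (auto simp: space_PiM PiE_def Pi_def)
  finally have b': "{\<omega> \<in> space M. Y t \<omega> \<in> b} \<in> sets ?VY" .
  show "{\<omega> \<in> space M. Y t \<omega> \<in> b} \<in> events" using indep_setD_ev2[OF ind] b' by blast
  have "\<P>(\<omega> in M. X r \<omega> \<in> a \<and> Y t \<omega> \<in> b) = prob ({\<omega> \<in> space M. X r \<omega> \<in> a} \<inter> {\<omega> \<in> space M. Y t \<omega> \<in> b})"
    by (rule arg_cong[where f = "measure M"]) auto
  also have "\<dots> = \<P>(\<omega> in M. X r \<omega> \<in> a) * \<P>(\<omega> in M. Y t \<omega> \<in> b)"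
    by (rule indep_setD[OF ind a' b'])
  finally show "\<P>(\<omega> in M. X r \<omega> \<in> a \<and> Y t \<omega> \<in> b) = \<P>(\<omega> in M. X r \<omega> \<in> a) * \<P>(\<omega> in M. Y t \<omega> \<in> b)" .
qed

context bounded_rate_jump_process
begin

lemma law_continuous: "continuous_on {0..} (law x)"
proof (cases "x \<in> S")
  case True
  show ?thesis
    by (rule DERIV_continuous_on[OF law_has_derivative[OF True]]) simp
next
  case False
  have "law x t = 0" if "0 \<le> t" for t
  proof -
    have "{\<omega> \<in> space M. X t \<omega> = x} = {}" using X_in_S[OF that] False by auto
    thus ?thesis by (simp only: measure_empty)
  qed
  thus ?thesis by (intro continuous_on_eq[OF continuous_on_const]) auto
qed

lemma law_bounds: "0 \<le> law x t" "law x t \<le> 1"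
  by (auto simp: measure_nonneg)

text \<open>
  Approximate \<open>Y t\<close> from the right by times \<open>T i\<close> with values in the grid of mesh \<open>1 / (i + 1)\<close>.  At the
  countably many grid times independence gives the formula by total probability.  In the limit, the left
  side converges because the paths of \<open>X\<close> are locally constant to the right of every time, and the
  right side because the state probabilities are continuous.
\<close>

lemma law_random_time:
  fixes Y :: "real \<Rightarrow> 'w \<Rightarrow> real"
  assumes indep: "indep_processes M (count_space S) X borel Y" and t: "0 \<le> t" and Y0: "\<And>\<omega>. 0 \<le> Y t \<omega>"
  shows "Y t \<in> borel_measurable M"
    and "{\<omega> \<in> space M. X (Y t \<omega>) \<omega> = x} \<in> events"
    and "\<P>(\<omega> in M. X (Y t \<omega>) \<omega> = x) = expectation (\<lambda>\<omega>. law x (Y t \<omega>))"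
proof -
  have XS: "X r \<in> space M \<rightarrow> space (count_space S)" if "0 \<le> r" for r using X_in_S[OF that] by auto
  have Yev: "{\<omega> \<in> space M. Y t \<omega> \<in> b} \<in> events" if "b \<in> sets borel" for b
    using indep_processesD(1)[OF indep t t XS _ _ that, of "{}"] by auto
  show Ym[measurable]: "Y t \<in> borel_measurable M"
  proof (rule measurableI)
    fix b :: "real set" assume "b \<in> sets borel"
    from Yev[OF this] show "Y t -` b \<inter> space M \<in> events" by (simp add: vimage_def Int_def conj_commute)
  qed simp
  \<comment> \<open>Adding \<open>1\<close> to the floor makes \<open>T i\<close> strictly larger than \<open>Y t\<close>, so that it converges from the right.\<close>
  define Z where "Z i \<omega> = nat \<lfloor>real (Suc i) * Y t \<omega>\<rfloor> + 1" for i \<omega>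
  define T where "T i \<omega> = real (Z i \<omega>) / real (Suc i)" for i \<omega>
  have Zm[measurable]: "Z i \<in> M \<rightarrow>\<^sub>M count_space UNIV" for i unfolding Z_def by measurable
  have T_bounds: "Y t \<omega> < T i \<omega>" "T i \<omega> \<le> Y t \<omega> + 1 / real (Suc i)" for i \<omega>
  proof -
    have "0 \<le> real (Suc i) * Y t \<omega>" using Y0 by simp
    hence "real (Suc i) * Y t \<omega> < real (Z i \<omega>)" "real (Z i \<omega>) \<le> real (Suc i) * Y t \<omega> + 1"
      unfolding Z_def by linarith+
    thus "Y t \<omega> < T i \<omega>" "T i \<omega> \<le> Y t \<omega> + 1 / real (Suc i)"
      by (simp_all add: T_def divide_simps mult.commute del: of_nat_Suc)
  qed
  have T_lim: "filterlim (\<lambda>i. T i \<omega>) (at_right (Y t \<omega>)) sequentially" for \<omega>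
  proof -
    have "(\<lambda>i. T i \<omega>) \<longlonglongrightarrow> Y t \<omega>"
    proof (rule tendsto_sandwich[where f = "\<lambda>_. Y t \<omega>" and h = "\<lambda>i. Y t \<omega> + 1 / real (Suc i)"])
      show "(\<lambda>i. Y t \<omega> + 1 / real (Suc i)) \<longlonglongrightarrow> Y t \<omega>" by real_asymp
      show "\<forall>\<^sub>F i in sequentially. Y t \<omega> \<le> T i \<omega>"
        by (intro always_eventually allI less_imp_le T_bounds(1))
      show "\<forall>\<^sub>F i in sequentially. T i \<omega> \<le> Y t \<omega> + 1 / real (Suc i)"
        by (intro always_eventually allI T_bounds(2))
    qed simp
    thus ?thesis using T_bounds(1) by (simp add: filterlim_at less_imp_neq[symmetric])
  qed
  have ev_T: "{\<omega> \<in> space M. X (T i \<omega>) \<omega> = x} \<in> events" for i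
  proof -
    have "{\<omega> \<in> space M. X (T i \<omega>) \<omega> = x} = (\<Union>j. {\<omega> \<in> space M. X (real j / real (Suc i)) \<omega> = x \<and> Z i \<omega> = j})"
      by (auto simp: T_def)
    also have "\<dots> \<in> events"
    proof (rule sets.countable_UN)
      have "{\<omega> \<in> space M. X (real j / real (Suc i)) \<omega> = x \<and> Z i \<omega> = j} \<in> events" for j
        using events_X[of "real j / real (Suc i)" x] by (intro sets.sets_Collect_conj) auto
      thus "range (\<lambda>j. {\<omega> \<in> space M. X (real j / real (Suc i)) \<omega> = x \<and> Z i \<omega> = j}) \<subseteq> events" by blast
    qed
    finally show ?thesis .
  qed
  have law_T: "\<P>(\<omega> in M. X (T i \<omega>) \<omega> = x) = expectation (\<lambda>\<omega>. law x (T i \<omega>))" for i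
  proof -
    have [measurable]: "(\<lambda>\<omega>. law x (T i \<omega>)) \<in> borel_measurable M"
      unfolding T_def by (rule measurable_compose[OF Zm]) simp
    have "ennreal (\<P>(\<omega> in M. X (T i \<omega>) \<omega> = x)) = (\<integral>\<^sup>+\<omega>. indicator {\<omega> \<in> space M. X (T i \<omega>) \<omega> = x} \<omega> \<partial>M)"
      using ev_T by (simp add: emeasure_eq_measure)
    also have "\<dots> = (\<integral>\<^sup>+j. (\<integral>\<^sup>+\<omega>. indicator {\<omega> \<in> space M. X (T i \<omega>) \<omega> = x} \<omega> * indicator {\<omega> \<in> space M. Z i \<omega> = j} \<omega> \<partial>M) \<partial>count_space UNIV)"
      by (rule nn_integral_countable_partition[OF Zm]) (use ev_T in auto)
    also have "\<dots> = (\<integral>\<^sup>+j. (\<integral>\<^sup>+\<omega>. ennreal (law x (T i \<omega>)) * indicator {\<omega> \<in> space M. Z i \<omega> = j} \<omega> \<partial>M) \<partial>count_space UNIV)"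
    proof (rule nn_integral_cong)
      fix j :: nat
      define r where "r = real j / real (Suc i)"
      define b where "b = {y. nat \<lfloor>real (Suc i) * y\<rfloor> + 1 = j}"
      have b: "b \<in> sets borel"
      proof -
        have "(\<lambda>y. nat \<lfloor>real (Suc i) * y\<rfloor> + 1) \<in> borel \<rightarrow>\<^sub>M count_space UNIV" by measurable
        from measurable_sets[OF this, of "{j}"] show ?thesis by (simp add: b_def vimage_def)
      qed
      have Zb: "Z i \<omega> = j \<longleftrightarrow> Y t \<omega> \<in> b" for \<omega> by (simp add: Z_def b_def)
      have r: "0 \<le> r" by (simp add: r_def)
      have "\<P>(\<omega> in M. X r \<omega> \<in> {x} \<inter> S \<and> Y t \<omega> \<in> b) = \<P>(\<omega> in M. X r \<omega> \<in> {x} \<inter> S) * \<P>(\<omega> in M. Y t \<omega> \<in> b)"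
        by (rule indep_processesD(2)[OF indep r t XS _ _ b]) auto
      moreover have "{\<omega> \<in> space M. X r \<omega> \<in> {x} \<inter> S \<and> Y t \<omega> \<in> b} = {\<omega> \<in> space M. X r \<omega> = x \<and> Y t \<omega> \<in> b}"
          "{\<omega> \<in> space M. X r \<omega> \<in> {x} \<inter> S} = {\<omega> \<in> space M. X r \<omega> = x}"
        using X_in_S[OF r] by auto
      ultimately have prod: "\<P>(\<omega> in M. X r \<omega> = x \<and> Z i \<omega> = j) = law x r * \<P>(\<omega> in M. Z i \<omega> = j)"
        unfolding Zb by simp
      have "(\<integral>\<^sup>+\<omega>. indicator {\<omega> \<in> space M. X (T i \<omega>) \<omega> = x} \<omega> * indicator {\<omega> \<in> space M. Z i \<omega> = j} \<omega> \<partial>M)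
        = (\<integral>\<^sup>+\<omega>. indicator {\<omega> \<in> space M. X r \<omega> = x \<and> Z i \<omega> = j} \<omega> \<partial>M)"
        by (intro nn_integral_cong) (auto simp: indicator_def T_def r_def)
      also have "\<dots> = ennreal (law x r * \<P>(\<omega> in M. Z i \<omega> = j))"
        using events_X[OF r, of x] unfolding prod[symmetric]
        by (subst nn_integral_indicator) (auto intro!: sets.sets_Collect_conj simp: emeasure_eq_measure)
      also have "\<dots> = (\<integral>\<^sup>+\<omega>. ennreal (law x r) * indicator {\<omega> \<in> space M. Z i \<omega> = j} \<omega> \<partial>M)"
        by (subst nn_integral_cmult_indicator) (auto simp: emeasure_eq_measure ennreal_mult)
      also have "\<dots> = (\<integral>\<^sup>+\<omega>. ennreal (law x (T i \<omega>)) * indicator {\<omega> \<in> space M. Z i \<omega> = j} \<omega> \<partial>M)"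
        by (intro nn_integral_cong) (auto simp: indicator_def T_def r_def)
      finally show "(\<integral>\<^sup>+\<omega>. indicator {\<omega> \<in> space M. X (T i \<omega>) \<omega> = x} \<omega> * indicator {\<omega> \<in> space M. Z i \<omega> = j} \<omega> \<partial>M)
        = (\<integral>\<^sup>+\<omega>. ennreal (law x (T i \<omega>)) * indicator {\<omega> \<in> space M. Z i \<omega> = j} \<omega> \<partial>M)" .
    qed
    also have "\<dots> = (\<integral>\<^sup>+\<omega>. ennreal (law x (T i \<omega>)) \<partial>M)"
      by (rule nn_integral_countable_partition[OF Zm, symmetric]) auto
    also have "\<dots> = ennreal (expectation (\<lambda>\<omega>. law x (T i \<omega>)))"
      by (rule nn_integral_eq_integral) (use law_bounds in \<open>auto intro!: integrable_const_bound[of _ 1]\<close>)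
    finally show ?thesis using law_bounds(1) by (subst (asm) ennreal_inj) (auto intro!: integral_nonneg_AE)
  qed
  have ind_lim: "(\<lambda>i. indicator {\<omega> \<in> space M. X (T i \<omega>) \<omega> = x} \<omega> :: real) \<longlonglongrightarrow> indicator {\<omega> \<in> space M. X (Y t \<omega>) \<omega> = x} \<omega>"
    if "\<omega> \<in> space M" for \<omega>
  proof -
    have "\<forall>\<^sub>F u in at_right (Y t \<omega>). X u \<omega> = X (Y t \<omega>) \<omega>"
      using jump that Y0 by (simp add: markov_jump_process_def)
    from eventually_compose_filterlim[OF this T_lim]
    have "\<forall>\<^sub>F i in sequentially. (indicator {\<omega> \<in> space M. X (T i \<omega>) \<omega> = x} \<omega> :: real) = indicator {\<omega> \<in> space M. X (Y t \<omega>) \<omega> = x} \<omega>"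
      by eventually_elim (auto simp: indicator_def)
    thus ?thesis by (rule tendsto_eventually)
  qed
  have ind_meas: "(\<lambda>\<omega>. indicator {\<omega> \<in> space M. X (Y t \<omega>) \<omega> = x} \<omega> :: real) \<in> borel_measurable M"
    by (rule borel_measurable_LIMSEQ_real[OF ind_lim]) (use ev_T in auto)
  thus ev: "{\<omega> \<in> space M. X (Y t \<omega>) \<omega> = x} \<in> events"
    by (subst (asm) borel_measurable_indicator_iff) (auto simp: Int_def conj_commute cong: conj_cong)
  have "(\<lambda>i. expectation (\<lambda>\<omega>. indicator {\<omega> \<in> space M. X (T i \<omega>) \<omega> = x} \<omega> :: real)) \<longlonglongrightarrow> expectation (\<lambda>\<omega>. indicator {\<omega> \<in> space M. X (Y t \<omega>) \<omega> = x} \<omega>)"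
  proof (rule integral_dominated_convergence[where w = "\<lambda>_. 1"])
    show "AE \<omega> in M. norm (indicator {\<omega> \<in> space M. X (T i \<omega>) \<omega> = x} \<omega> :: real) \<le> 1" for i
      by (auto simp: indicator_def)
  qed (use ind_meas ev_T ind_lim in auto)
  hence 1: "(\<lambda>i. \<P>(\<omega> in M. X (T i \<omega>) \<omega> = x)) \<longlonglongrightarrow> \<P>(\<omega> in M. X (Y t \<omega>) \<omega> = x)"
    using ev_T ev by (simp add: Int_absorb2 sets.sets_into_space)
  have 2: "(\<lambda>i. expectation (\<lambda>\<omega>. law x (T i \<omega>))) \<longlonglongrightarrow> expectation (\<lambda>\<omega>. law x (Y t \<omega>))"
  proof (rule integral_dominated_convergence[where w = "\<lambda>_. 1"])
    show "(\<lambda>\<omega>. law x (T i \<omega>)) \<in> borel_measurable M" for i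
      unfolding T_def by (rule measurable_compose[OF Zm]) simp
    have lim: "(\<lambda>i. law x (T i \<omega>)) \<longlonglongrightarrow> law x (Y t \<omega>)" for \<omega>
    proof (rule continuous_on_tendsto_compose[OF law_continuous])
      show "(\<lambda>i. T i \<omega>) \<longlonglongrightarrow> Y t \<omega>" using T_lim[of \<omega>] by (simp add: filterlim_at)
    qed (use Y0 in \<open>auto simp: T_def\<close>)
    show "(\<lambda>\<omega>. law x (Y t \<omega>)) \<in> borel_measurable M"
      by (rule borel_measurable_LIMSEQ_real[OF lim]) (auto simp: T_def intro: measurable_compose[OF Zm])
    show "AE \<omega> in M. (\<lambda>i. law x (T i \<omega>)) \<longlonglongrightarrow> law x (Y t \<omega>)" using lim by auto
  qed (use law_bounds in auto)
  show "\<P>(\<omega> in M. X (Y t \<omega>) \<omega> = x) = expectation (\<lambda>\<omega>. law x (Y t \<omega>))"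
    using LIMSEQ_unique[OF 1 2[folded law_T]] .
qed

context
  fixes \<alpha> :: real and D Y :: "real \<Rightarrow> 'w \<Rightarrow> real"
  assumes \<alpha>: "0 < \<alpha>" "\<alpha> < 1" and D: "stable_subordinator M \<alpha> D"
    and Y: "Y = first_hitting_time D" and indep: "indep_processes M (count_space S) X borel Y"
begin

lemma Y_nonneg: "0 \<le> Y t \<omega>"
  unfolding Y by (rule first_hitting_time_nonneg[OF prob_space_axioms \<alpha>(1) D])

lemma time_changed_law:
  assumes t: "0 \<le> t"
  shows "\<P>(\<omega> in M. X (Y t \<omega>) \<omega> = x) = expectation (\<lambda>\<omega>. law x (t powr \<alpha> * D 1 \<omega> powr - \<alpha>))"
proof -
  let ?W = "\<lambda>\<omega>. t powr \<alpha> * D 1 \<omega> powr - \<alpha>"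
  have [measurable]: "Y t \<in> borel_measurable M" by (rule law_random_time(1)[OF indep t Y_nonneg])
  have [measurable]: "D 1 \<in> borel_measurable M"
    by (rule subordinator_measurable[OF prob_space_axioms \<alpha>(1) D]) simp
  define L where "L s = law x (max 0 s)" for s
  have "continuous_on UNIV L" unfolding L_def
    by (rule continuous_on_compose2[OF law_continuous]) (auto intro!: continuous_intros)
  hence [measurable]: "L \<in> borel_measurable borel" by (rule borel_measurable_continuous_onI)
  have "\<P>(\<omega> in M. X (Y t \<omega>) \<omega> = x) = expectation (\<lambda>\<omega>. L (Y t \<omega>))"
    using Y_nonneg by (simp add: law_random_time(3)[OF indep t Y_nonneg] L_def max_absorb2)
  also have "\<dots> = (\<integral>s. L s \<partial>distr M borel (Y t))" by (rule integral_distr[symmetric]) auto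
  also have "distr M borel (Y t) = distr M borel ?W"
    unfolding Y by (rule distr_first_hitting_time[OF prob_space_axioms \<alpha>(1) D t]) (simp add: Y[symmetric])
  also have "(\<integral>s. L s \<partial>distr M borel ?W) = expectation (\<lambda>\<omega>. L (?W \<omega>))" by (rule integral_distr) auto
  also have "\<dots> = expectation (\<lambda>\<omega>. law x (?W \<omega>))" by (simp add: L_def max_absorb2)
  finally show ?thesis .
qed

text \<open>
  The forward equation, transported by \<open>has_caputo_derivative_mittag_leffler_mixture\<close>.  The Caputo
  derivative depends on \<open>f\<close> only through its values at nonnegative times.
\<close>

proposition fractional_forward_equation:
  assumes t: "0 < t" and y: "y \<in> S"
    and A: "finite A" "y \<notin> A" "\<And>x. x \<in> S \<Longrightarrow> x \<notin> A \<Longrightarrow> x \<noteq> y \<Longrightarrow> q x y = 0"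
    and f: "\<And>t. 0 \<le> t \<Longrightarrow> f t = \<P>(\<omega> in M. X (Y t \<omega>) \<omega> = y)"
  shows "has_caputo_derivative \<alpha> f
     ((\<Sum>x\<in>A. q x y * \<P>(\<omega> in M. X (Y t \<omega>) \<omega> = x)) - out_rate y * \<P>(\<omega> in M. X (Y t \<omega>) \<omega> = y)) t"
proof -
  define W where "W \<omega> = D 1 \<omega> powr - \<alpha>" for \<omega>
  define G where "G s = (\<Sum>x\<in>A. q x y * law x s) - out_rate y * law y s" for s
  have Dm: "D 1 \<in> borel_measurable M"
    by (rule subordinator_measurable[OF prob_space_axioms \<alpha>(1) D]) simp
  hence Wm[measurable]: "W \<in> borel_measurable M" unfolding W_def by measurable
  have W: "mittag_leffler_variable \<alpha> M W"
    using subordinator_moment[OF prob_space_axioms \<alpha>(1) D] Wm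
    by (simp add: mittag_leffler_variable_def W_def)
  have law_W: "\<P>(\<omega> in M. X (Y t \<omega>) \<omega> = x) = expectation (\<lambda>\<omega>. law x (t powr \<alpha> * W \<omega>))" if "0 \<le> t" for t x
    using time_changed_law[OF that] by (simp add: W_def)
  have "has_caputo_derivative \<alpha> f (expectation (\<lambda>\<omega>. G (t powr \<alpha> * W \<omega>))) t"
  proof (rule has_caputo_derivative_mittag_leffler_mixture[OF \<alpha> t W])
    show "(law y has_real_derivative G s) (at s within {0..})" if "0 \<le> s" for s
      unfolding G_def by (rule forward_equation[OF y that A])
    show "continuous_on {0..} G" unfolding G_def
      by (intro continuous_intros law_continuous)
    show "\<bar>law y s\<bar> \<le> 1" for s using law_bounds[of s y] by simp
    show "\<bar>G s\<bar> \<le> (\<Sum>x\<in>A. \<bar>q x y\<bar>) + \<bar>out_rate y\<bar>" for s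
    proof -
      have "\<bar>q x y * law x s\<bar> \<le> \<bar>q x y\<bar>" "\<bar>out_rate y * law x s\<bar> \<le> \<bar>out_rate y\<bar>" for x
        using law_bounds[of s x] by (auto simp: abs_mult intro!: mult_left_le)
      hence "\<bar>\<Sum>x\<in>A. q x y * law x s\<bar> \<le> (\<Sum>x\<in>A. \<bar>q x y\<bar>)" "\<bar>out_rate y * law y s\<bar> \<le> \<bar>out_rate y\<bar>"
        by (auto intro!: order_trans[OF sum_abs] sum_mono)
      thus ?thesis unfolding G_def by linarith
    qed
  qed (simp add: f law_W)
  also have "expectation (\<lambda>\<omega>. G (t powr \<alpha> * W \<omega>)) = (\<Sum>x\<in>A. q x y * \<P>(\<omega> in M. X (Y t \<omega>) \<omega> = x)) - out_rate y * \<P>(\<omega> in M. X (Y t \<omega>) \<omega> = y)"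
  proof -
    have "continuous_on UNIV (\<lambda>s. law x (max 0 s))" for x
      by (rule continuous_on_compose2[OF law_continuous]) (auto intro!: continuous_intros)
    hence "(\<lambda>s. law x (max 0 s)) \<in> borel_measurable borel" for x by (rule borel_measurable_continuous_onI)
    hence "(\<lambda>\<omega>. law x (max 0 (t powr \<alpha> * W \<omega>))) \<in> borel_measurable M" for x
      by (rule measurable_compose[rotated]) simp
    hence "(\<lambda>\<omega>. law x (t powr \<alpha> * W \<omega>)) \<in> borel_measurable M" for x
      by (simp add: max_absorb2 W_def)
    hence int: "has_bochner_integral M (\<lambda>\<omega>. law x (t powr \<alpha> * W \<omega>)) (\<P>(\<omega> in M. X (Y t \<omega>) \<omega> = x))" for x
      unfolding law_W[OF less_imp_le[OF t]] has_bochner_integral_iff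
      using law_bounds by (auto intro!: integrable_const_bound[of _ 1])
    show ?thesis unfolding G_def
      by (rule has_bochner_integral_integral_eq)
         (intro has_bochner_integral_diff has_bochner_integral_sum has_bochner_integral_mult_right int)
  qed
  finally show ?thesis .
qed

end

end

section \<open>The Erlang queue with multiple arrivals\<close>

text \<open>
  At most one transition of each kind leads out of a given state; naming its target turns the sum of
  the rates over all states into a sum over the possible events.
\<close>

definition arrival_target :: "nat \<Rightarrow> nat \<Rightarrow> nat \<times> nat \<Rightarrow> nat \<times> nat" where
  "arrival_target k m x = (if x = (0, 0) then (m, k) else (fst x + m, snd x))"

definition service_target :: "nat \<Rightarrow> nat \<times> nat \<Rightarrow> nat \<times> nat" where
  "service_target k x =
     (if 2 \<le> snd x then (fst x, snd x - 1) else if 2 \<le> fst x then (fst x - 1, k) else (0, 0))"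

lemma erlang_arrival_iff:
  "x \<in> erlang_states k \<Longrightarrow> erlang_arrival k m x y \<longleftrightarrow> y = arrival_target k m x"
  by (auto simp: erlang_states_def erlang_busy_states_def erlang_arrival_def arrival_target_def)

lemma erlang_service_iff:
  "x \<in> erlang_busy_states k \<Longrightarrow> erlang_service k x y \<longleftrightarrow> y = service_target k x"
  by (auto simp: erlang_busy_states_def erlang_service_def service_target_def)

lemma erlang_service_idle: "\<not> erlang_service k (0, 0) y"
  by (auto simp: erlang_service_def)

lemma infsum_finite_support:
  fixes f :: "'a \<Rightarrow> real"
  assumes "finite B" "B \<subseteq> A" "\<And>y. y \<in> A \<Longrightarrow> y \<notin> B \<Longrightarrow> f y = 0"
  shows "(\<Sum>\<^sub>\<infinity>y\<in>A. f y) = (\<Sum>y\<in>B. f y)"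
proof -
  have "(\<Sum>\<^sub>\<infinity>y\<in>A. f y) = (\<Sum>\<^sub>\<infinity>y\<in>B. f y)"
    by (rule infsum_cong_neutral) (use assms in auto)
  thus ?thesis using assms(1) by simp
qed

text \<open>
  The rate from \<open>x\<close> to \<open>y\<close> is itself a sum over the events that lead from \<open>x\<close> to \<open>y\<close>.  Exchanging the
  summations leaves, for every event, its rate times the number \<open>1\<close> of its targets.
\<close>

lemma erlang_out_rate:
  assumes k: "1 \<le> k" and x: "x \<in> erlang_states k"
  shows "(\<Sum>\<^sub>\<infinity>y\<in>erlang_states k - {x}. erlang_rate k l \<mu> lam x y)
           = (\<Sum>m = 1..l. lam m) + (if x = (0, 0) then 0 else real k * \<mu>)"
proof -
  define tgt where "tgt m = arrival_target k m x" for m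
  define st where "st = service_target k x"
  define busy where "busy \<longleftrightarrow> x \<noteq> (0, 0)"
  define B where "B = tgt ` {1..l} \<union> (if busy then {st} else {})"
  have busyD: "x \<in> erlang_busy_states k" if busy using that x by (auto simp: busy_def erlang_states_def)
  have rate: "erlang_rate k l \<mu> lam x y = (\<Sum>m = 1..l. if y = tgt m then lam m else 0) + (if busy \<and> y = st then real k * \<mu> else 0)" for y
    using erlang_arrival_iff[OF x] erlang_service_iff[OF busyD] erlang_service_idle[of k y]
    unfolding erlang_rate_def by (cases busy) (auto simp: tgt_def st_def busy_def)
  have fin: "finite B" by (simp add: B_def)
  have sub: "B \<subseteq> erlang_states k - {x}"
    using k x by (auto simp: B_def tgt_def st_def busy_def erlang_states_def erlang_busy_states_def
        arrival_target_def service_target_def split: if_splits)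
  have "(\<Sum>\<^sub>\<infinity>y\<in>erlang_states k - {x}. erlang_rate k l \<mu> lam x y) = (\<Sum>y\<in>B. erlang_rate k l \<mu> lam x y)"
  proof (rule infsum_finite_support[OF fin sub])
    fix y assume "y \<notin> B"
    thus "erlang_rate k l \<mu> lam x y = 0"
      unfolding rate by (auto simp: B_def intro!: sum.neutral split: if_splits)
  qed
  also have "\<dots> = (\<Sum>m = 1..l. \<Sum>y\<in>B. if y = tgt m then lam m else 0) + (\<Sum>y\<in>B. if busy \<and> y = st then real k * \<mu> else 0)"
    unfolding rate sum.distrib by (subst sum.swap) simp
  also have "(\<Sum>m = 1..l. \<Sum>y\<in>B. if y = tgt m then lam m else 0) = (\<Sum>m = 1..l. lam m)"
    using fin by (intro sum.cong) (auto simp: B_def)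
  also have "(\<Sum>y\<in>B. if busy \<and> y = st then real k * \<mu> else 0) = (if x = (0, 0) then 0 else real k * \<mu>)"
    using fin by (cases busy) (auto simp: B_def busy_def)
  finally show ?thesis .
qed

lemma erlang_rate_eq_0:
  assumes "\<And>m. m \<in> {1..l} \<Longrightarrow> \<not> erlang_arrival k m x y" "\<not> erlang_service k x y"
  shows "erlang_rate k l \<mu> lam x y = 0"
  using assms by (auto simp: erlang_rate_def intro!: sum.neutral)

lemma erlang_rate_service:
  assumes "\<And>m. m \<in> {1..l} \<Longrightarrow> \<not> erlang_arrival k m x y" "erlang_service k x y"
  shows "erlang_rate k l \<mu> lam x y = real k * \<mu>"
proof -
  have "(\<Sum>m = 1..l. if erlang_arrival k m x y then lam m else 0) = 0"
    using assms by (intro sum.neutral) auto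
  thus ?thesis using assms by (simp add: erlang_rate_def)
qed

lemma erlang_rate_arrival:
  assumes "m \<in> {1..l}" "\<And>m'. erlang_arrival k m' x y \<longleftrightarrow> m' = m" "\<not> erlang_service k x y"
  shows "erlang_rate k l \<mu> lam x y = lam m"
  using assms by (simp add: erlang_rate_def)

lemma countable_erlang_states: "countable (erlang_states k)"
  by (rule countable_subset[OF subset_UNIV]) auto

lemmas erlang_defs = erlang_arrival_def erlang_service_def erlang_states_def erlang_busy_states_def

theorem theorem3p1:
  fixes M :: "'w measure"
    and k l :: nat
    and \<mu> \<Lambda> \<alpha> :: real
    and lam c :: "nat \<Rightarrow> real"
    and Q :: "real \<Rightarrow> 'w \<Rightarrow> nat \<times> nat"
    and D Y :: "real \<Rightarrow> 'w \<Rightarrow> real"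
    and Q\<alpha> :: "real \<Rightarrow> 'w \<Rightarrow> nat \<times> nat"
    and p :: "nat \<Rightarrow> nat \<Rightarrow> real \<Rightarrow> real"
  assumes "prob_space M"
    and "1 \<le> k" and "1 \<le> l" and "0 < \<mu>"
    and "\<And>m. m \<in> {1..l} \<Longrightarrow> 0 < lam m"
    and "\<Lambda> = (\<Sum>m = 1..l. lam m)"
    and "\<And>m. m \<in> {1..l} \<Longrightarrow> c m = lam m / \<Lambda>"
    and "erlang_queue M k l \<mu> lam Q"
    and "0 < \<alpha>" and "\<alpha> < 1"
    and "stable_subordinator M \<alpha> D"
    and "Y = first_hitting_time D"
    and "indep_processes M (count_space (erlang_states k)) Q borel Y"
    and "Q\<alpha> = time_changed Q Y"
    and "p = (\<lambda>n s t. \<P>(\<omega> in M. Q\<alpha> t \<omega> = (n, s) \<bar> Q\<alpha> 0 \<omega> = (0, 0)))"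
  shows "(\<forall>t>0.
            has_caputo_derivative \<alpha> (p 0 0) (- \<Lambda> * p 0 0 t + k * \<mu> * p 1 1 t) t \<and>
            (\<forall>s\<in>{1..k - 1}.
               has_caputo_derivative \<alpha> (p 1 s)
                 (- (\<Lambda> + k * \<mu>) * p 1 s t + k * \<mu> * p 1 (s + 1) t) t) \<and>
            has_caputo_derivative \<alpha> (p 1 k)
              (- (\<Lambda> + k * \<mu>) * p 1 k t + k * \<mu> * p 2 1 t + \<Lambda> * c 1 * p 0 0 t) t \<and>
            (\<forall>n\<ge>2. \<forall>s\<in>{1..k - 1}.
               has_caputo_derivative \<alpha> (p n s)
                 (- (\<Lambda> + k * \<mu>) * p n s t + k * \<mu> * p n (s + 1) t
                  + \<Lambda> * (\<Sum>m = 1..min n l. c m * p (n - m) s t)) t) \<and>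
            (\<forall>n\<in>{2..l}.
               has_caputo_derivative \<alpha> (p n k)
                 (- (\<Lambda> + k * \<mu>) * p n k t + k * \<mu> * p (n + 1) 1 t
                  + \<Lambda> * (\<Sum>m = 1..n - 1. c m * p (n - m) k t) + \<Lambda> * c n * p 0 0 t) t) \<and>
            (\<forall>n>l.
               has_caputo_derivative \<alpha> (p n k)
                 (- (\<Lambda> + k * \<mu>) * p n k t + k * \<mu> * p (n + 1) 1 t
                  + \<Lambda> * (\<Sum>m = 1..l. c m * p (n - m) k t)) t)) \<and>
         p 0 0 0 = 1 \<and>
         (\<forall>n\<ge>1. \<forall>s\<in>{1..k}. p n s 0 = 0)"
proof -
  note k = \<open>1 \<le> k\<close> and l = \<open>1 \<le> l\<close> and \<mu> = \<open>0 < \<mu>\<close> and lam = \<open>\<And>m. m \<in> {1..l} \<Longrightarrow> 0 < lam m\<close>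
  note \<alpha> = \<open>0 < \<alpha>\<close> \<open>\<alpha> < 1\<close> and D = \<open>stable_subordinator M \<alpha> D\<close> and Y = \<open>Y = first_hitting_time D\<close>
  note indep = \<open>indep_processes M (count_space (erlang_states k)) Q borel Y\<close>
  have jump: "markov_jump_process M (erlang_states k) (erlang_rate k l \<mu> lam) Q"
    and Q0: "AE \<omega> in M. Q 0 \<omega> = (0, 0)"
    using \<open>erlang_queue M k l \<mu> lam Q\<close> by (auto simp: erlang_queue_def)
  have \<Lambda>: "0 < \<Lambda>" unfolding \<open>\<Lambda> = _\<close> using l lam by (intro sum_pos) auto
  have \<Lambda>c: "\<Lambda> * c m = lam m" if "m \<in> {1..l}" for m
    using \<open>\<And>m. m \<in> {1..l} \<Longrightarrow> c m = lam m / \<Lambda>\<close>[OF that] \<Lambda> by simp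
  interpret prob_space M by fact
  interpret Q: bounded_rate_jump_process M "erlang_states k" "erlang_rate k l \<mu> lam" Q "\<Lambda> + real k * \<mu>"
  proof
    show "(\<Sum>\<^sub>\<infinity>y\<in>erlang_states k - {x}. erlang_rate k l \<mu> lam x y) \<le> \<Lambda> + real k * \<mu>"
      if "x \<in> erlang_states k" for x
      using \<mu> by (simp add: erlang_out_rate[OF k that] \<open>\<Lambda> = _\<close>)
  qed (rule jump countable_erlang_states)+
  define P where "P x t = \<P>(\<omega> in M. Q (Y t \<omega>) \<omega> = x)" for x t
  have Y_nonneg: "0 \<le> Y t \<omega>" for t \<omega> by (rule Q.Y_nonneg[OF \<alpha> D Y indep])
  have Q_init: "Q.law x 0 = (if x = (0, 0) then 1 else 0)" for x
  proof (cases "x = (0, 0)")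
    case True
    thus ?thesis using Q0 Q.events_X[of 0 x] by (simp add: prob_eq_1)
  next
    case False
    have "Q.law x 0 = prob {}"
      using Q0 False by (intro finite_measure_eq_AE) (use Q.events_X[of 0 x] in auto)
    thus ?thesis using False by simp
  qed
  have P_init: "P x 0 = (if x = (0, 0) then 1 else 0)" for x
    unfolding P_def Q.time_changed_law[OF \<alpha> D Y indep order_refl] by (simp add: Q_init prob_space)
  have Q_events: "{\<omega> \<in> space M. Q (Y t \<omega>) \<omega> = x} \<in> events" if "0 \<le> t" for x t
    by (rule Q.law_random_time(2)[OF indep that Y_nonneg])
  \<comment> \<open>Almost surely \<open>Y 0 = 0\<close> and the queue starts empty, so the conditioning is on an almost sure event.\<close>
  have p_eq: "p n s t = P (n, s) t" if "0 \<le> t" for n s t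
  proof -
    have AE0: "AE \<omega> in M. Q (Y 0 \<omega>) \<omega> = (0, 0)"
      using P_init[of "(0, 0)"] Q_events[of 0 "(0, 0)"] by (simp add: P_def prob_eq_1)
    have "\<P>(\<omega> in M. Q (Y t \<omega>) \<omega> = (n, s) \<and> Q (Y 0 \<omega>) \<omega> = (0, 0)) = P (n, s) t"
      unfolding P_def using AE0 Q_events[OF that] Q_events[of 0]
      by (intro finite_measure_eq_AE) (auto intro!: sets.sets_Collect_conj)
    thus ?thesis using P_init[of "(0, 0)"]
      by (simp add: \<open>p = _\<close> \<open>Q\<alpha> = _\<close> time_changed_def cond_prob_def P_def)
  qed
  have P_0: "P (0, s) t = 0" if "1 \<le> s" "0 \<le> t" for s t
  proof -
    have "{\<omega> \<in> space M. Q (Y t \<omega>) \<omega> = (0, s)} = {}"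
    proof -
      have "(0, s) \<notin> erlang_states k" using that by (simp add: erlang_states_def erlang_busy_states_def)
      thus ?thesis using Q.X_in_S[OF Y_nonneg] by (metis (mono_tags, lifting) Collect_empty_eq)
    qed
    thus ?thesis by (simp only: P_def measure_empty)
  qed
  have forward: "has_caputo_derivative \<alpha> (p n s) d t"
    if "0 < t" "(n, s) \<in> erlang_states k" "finite pre" "(n, s) \<notin> pre"
      and "\<And>x. x \<in> erlang_states k \<Longrightarrow> x \<notin> pre \<Longrightarrow> x \<noteq> (n, s) \<Longrightarrow> erlang_rate k l \<mu> lam x (n, s) = 0"
      and "d = (\<Sum>x\<in>pre. erlang_rate k l \<mu> lam x (n, s) * P x t)
               - (\<Lambda> + (if (n, s) = (0, 0) then 0 else real k * \<mu>)) * P (n, s) t"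
    for n s d t pre
    using Q.fractional_forward_equation[OF \<alpha> D Y indep that(1-5), of "p n s"] that(2,6)
    by (simp add: p_eq P_def erlang_out_rate[OF k] \<open>\<Lambda> = _\<close>)
  let ?q = "erlang_rate k l \<mu> lam"
  have eq1: "has_caputo_derivative \<alpha> (p 0 0) (- \<Lambda> * p 0 0 t + k * \<mu> * p 1 1 t) t" if t: "0 < t" for t
  proof (rule forward[of t 0 0 "{(1, 1)}", OF t])
    have "?q (1, 1) (0, 0) = k * \<mu>"
      by (rule erlang_rate_service) (auto simp: erlang_defs)
    thus "- \<Lambda> * p 0 0 t + k * \<mu> * p 1 1 t = (\<Sum>x\<in>{(1, 1)}. ?q x (0, 0) * P x t) - (\<Lambda> + (if (0::nat, 0::nat) = (0, 0) then 0 else k * \<mu>)) * P (0, 0) t"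
      using t by (simp add: p_eq)
    show "?q x (0, 0) = 0" if "x \<in> erlang_states k" "x \<notin> {(1, 1)}" "x \<noteq> (0, 0)" for x
      using that by (intro erlang_rate_eq_0) (auto simp: erlang_defs)
  qed (use k in \<open>auto simp: erlang_defs\<close>)
  have eq2: "has_caputo_derivative \<alpha> (p 1 s) (- (\<Lambda> + k * \<mu>) * p 1 s t + k * \<mu> * p 1 (s + 1) t) t"
    if t: "0 < t" and s: "s \<in> {1..k - 1}" for t s
  proof (rule forward[of t 1 s "{(1, s + 1)}", OF t])
    have "?q (1, s + 1) (1, s) = k * \<mu>"
      using s by (intro erlang_rate_service) (auto simp: erlang_defs)
    thus "- (\<Lambda> + k * \<mu>) * p 1 s t + k * \<mu> * p 1 (s + 1) t
        = (\<Sum>x\<in>{(1, s + 1)}. ?q x (1, s) * P x t) - (\<Lambda> + (if (1::nat, s) = (0, 0) then 0 else k * \<mu>)) * P (1, s) t"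
      using t by (simp add: p_eq algebra_simps)
    show "?q x (1, s) = 0" if "x \<in> erlang_states k" "x \<notin> {(1, s + 1)}" "x \<noteq> (1, s)" for x
      using that s by (intro erlang_rate_eq_0) (auto simp: erlang_defs)
  qed (use s in \<open>auto simp: erlang_defs\<close>)
  have eq3: "has_caputo_derivative \<alpha> (p 1 k) (- (\<Lambda> + k * \<mu>) * p 1 k t + k * \<mu> * p 2 1 t + \<Lambda> * c 1 * p 0 0 t) t"
    if t: "0 < t" for t
  proof (rule forward[of t 1 k "{(2, 1), (0, 0)}", OF t])
    have "?q (2, 1) (1, k) = k * \<mu>"
      using k by (intro erlang_rate_service) (auto simp: erlang_defs)
    moreover have "?q (0, 0) (1, k) = lam 1"
      using l by (intro erlang_rate_arrival) (auto simp: erlang_defs)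
    ultimately show "- (\<Lambda> + k * \<mu>) * p 1 k t + k * \<mu> * p 2 1 t + \<Lambda> * c 1 * p 0 0 t
        = (\<Sum>x\<in>{(2, 1), (0, 0)}. ?q x (1, k) * P x t) - (\<Lambda> + (if (1::nat, k) = (0, 0) then 0 else k * \<mu>)) * P (1, k) t"
      using t l by (simp add: p_eq \<Lambda>c algebra_simps)
    show "?q x (1, k) = 0" if "x \<in> erlang_states k" "x \<notin> {(2, 1), (0, 0)}" "x \<noteq> (1, k)" for x
      using that by (intro erlang_rate_eq_0) (auto simp: erlang_defs)
  qed (use k in \<open>auto simp: erlang_defs\<close>)
  have eq4: "has_caputo_derivative \<alpha> (p n s)
      (- (\<Lambda> + k * \<mu>) * p n s t + k * \<mu> * p n (s + 1) t + \<Lambda> * (\<Sum>m = 1..min n l. c m * p (n - m) s t)) t"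
    if t: "0 < t" and n: "2 \<le> n" and s: "s \<in> {1..k - 1}" for t n s
  proof (rule forward[of t n s "insert (n, s + 1) ((\<lambda>m. (n - m, s)) ` {1..min n l})", OF t])
    let ?B = "(\<lambda>m. (n - m, s)) ` {1..min n l}"
    have inj: "inj_on (\<lambda>m. (n - m, s)) {1..min n l}" by (auto simp: inj_on_def)
    have serv: "?q (n, s + 1) (n, s) = k * \<mu>"
      using s n by (intro erlang_rate_service) (auto simp: erlang_defs)
    \<comment> \<open>For \<open>m = n\<close> the would-be predecessor \<open>(0, s)\<close> is not a state, and both sides are \<open>0\<close>.\<close>
    have arr: "?q (n - m, s) (n, s) * P (n - m, s) t = \<Lambda> * (c m * p (n - m) s t)" if m: "m \<in> {1..min n l}" for m
    proof (cases "m = n")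
      case True
      thus ?thesis using P_0[of s t] s t by (simp add: p_eq)
    next
      case False
      have "?q (n - m, s) (n, s) = lam m"
        using m s False by (intro erlang_rate_arrival) (auto simp: erlang_defs)
      thus ?thesis using m t by (simp add: p_eq \<Lambda>c[symmetric])
    qed
    have "(\<Sum>x\<in>insert (n, s + 1) ?B. ?q x (n, s) * P x t) = k * \<mu> * p n (s + 1) t + (\<Sum>x\<in>?B. ?q x (n, s) * P x t)"
      using t serv by (subst sum.insert) (auto simp: p_eq)
    also have "(\<Sum>x\<in>?B. ?q x (n, s) * P x t) = \<Lambda> * (\<Sum>m = 1..min n l. c m * p (n - m) s t)"
      unfolding sum.reindex[OF inj] o_def sum_distrib_left by (rule sum.cong[OF refl arr])
    finally show "- (\<Lambda> + k * \<mu>) * p n s t + k * \<mu> * p n (s + 1) t + \<Lambda> * (\<Sum>m = 1..min n l. c m * p (n - m) s t)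
        = (\<Sum>x\<in>insert (n, s + 1) ?B. ?q x (n, s) * P x t) - (\<Lambda> + (if (n, s) = (0, 0) then 0 else k * \<mu>)) * P (n, s) t"
      using t n by (simp add: p_eq algebra_simps)
    show "?q x (n, s) = 0" if "x \<in> erlang_states k" "x \<notin> insert (n, s + 1) ?B" "x \<noteq> (n, s)" for x
    proof (rule erlang_rate_eq_0)
      show "\<not> erlang_service k x (n, s)" using that s n by (auto simp: erlang_defs)
      fix m assume m: "m \<in> {1..l}"
      show "\<not> erlang_arrival k m x (n, s)"
      proof
        assume "erlang_arrival k m x (n, s)"
        hence "x = (n - m, s)" "m \<le> n" using s by (auto simp: erlang_defs)
        thus False using that(2) m by auto
      qed
    qed
  qed (use s n in \<open>auto simp: erlang_defs\<close>)
  \<comment> \<open>The arrivals into \<open>(n, k)\<close> from busy states; the one from the idle state is treated separately.\<close>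
  have sum_arrivals: "(\<Sum>x\<in>(\<lambda>m. (n - m, k)) ` {1..b}. ?q x (n, k) * P x t) = \<Lambda> * (\<Sum>m = 1..b. c m * p (n - m) k t)"
    if t: "0 < t" and b: "b < n" "b \<le> l" for t n b
  proof -
    have inj: "inj_on (\<lambda>m. (n - m, k)) {1..b}" using b by (auto simp: inj_on_def)
    have "?q (n - m, k) (n, k) * P (n - m, k) t = \<Lambda> * (c m * p (n - m) k t)" if m: "m \<in> {1..b}" for m
    proof -
      have "?q (n - m, k) (n, k) = lam m"
        using m b k by (intro erlang_rate_arrival) (auto simp: erlang_defs)
      thus ?thesis using m t b by (simp add: p_eq \<Lambda>c[symmetric])
    qed
    thus ?thesis unfolding sum.reindex[OF inj] o_def sum_distrib_left by (intro sum.cong refl) auto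
  qed
  have eq5: "has_caputo_derivative \<alpha> (p n k)
      (- (\<Lambda> + k * \<mu>) * p n k t + k * \<mu> * p (n + 1) 1 t + \<Lambda> * (\<Sum>m = 1..n - 1. c m * p (n - m) k t) + \<Lambda> * c n * p 0 0 t) t"
    if t: "0 < t" and n: "n \<in> {2..l}" for t n
  proof (rule forward[of t n k "insert (n + 1, 1) (insert (0, 0) ((\<lambda>m. (n - m, k)) ` {1..n - 1}))", OF t])
    let ?B = "(\<lambda>m. (n - m, k)) ` {1..n - 1}"
    have serv: "?q (n + 1, 1) (n, k) = k * \<mu>"
      using n k by (intro erlang_rate_service) (auto simp: erlang_defs)
    have idle: "?q (0, 0) (n, k) = lam n"
      using n k by (intro erlang_rate_arrival) (auto simp: erlang_defs)
    have "(\<Sum>x\<in>insert (n + 1, 1) (insert (0, 0) ?B). ?q x (n, k) * P x t)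
        = k * \<mu> * p (n + 1) 1 t + (\<Lambda> * c n * p 0 0 t + (\<Sum>x\<in>?B. ?q x (n, k) * P x t))"
      using t serv idle n k by (subst sum.insert, simp, fastforce, subst sum.insert, simp, fastforce) (simp add: p_eq \<Lambda>c)
    also have "(\<Sum>x\<in>?B. ?q x (n, k) * P x t) = \<Lambda> * (\<Sum>m = 1..n - 1. c m * p (n - m) k t)"
      using n by (intro sum_arrivals t) auto
    finally show "- (\<Lambda> + k * \<mu>) * p n k t + k * \<mu> * p (n + 1) 1 t + \<Lambda> * (\<Sum>m = 1..n - 1. c m * p (n - m) k t) + \<Lambda> * c n * p 0 0 t
        = (\<Sum>x\<in>insert (n + 1, 1) (insert (0, 0) ?B). ?q x (n, k) * P x t) - (\<Lambda> + (if (n, k) = (0, 0) then 0 else k * \<mu>)) * P (n, k) t"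
      using t n by (simp add: p_eq algebra_simps)
    show "?q x (n, k) = 0" if "x \<in> erlang_states k" "x \<notin> insert (n + 1, 1) (insert (0, 0) ?B)" "x \<noteq> (n, k)" for x
    proof (rule erlang_rate_eq_0)
      show "\<not> erlang_service k x (n, k)" using that n by (auto simp: erlang_defs)
      fix m assume m: "m \<in> {1..l}"
      show "\<not> erlang_arrival k m x (n, k)"
      proof
        assume "erlang_arrival k m x (n, k)"
        hence "x = (n - m, k)" "m \<le> n - 1" using that by (auto simp: erlang_defs)
        thus False using that(2) m by auto
      qed
    qed
  qed (use n k in \<open>auto simp: erlang_defs\<close>)
  have eq6: "has_caputo_derivative \<alpha> (p n k)
      (- (\<Lambda> + k * \<mu>) * p n k t + k * \<mu> * p (n + 1) 1 t + \<Lambda> * (\<Sum>m = 1..l. c m * p (n - m) k t)) t"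
    if t: "0 < t" and n: "l < n" for t n
  proof (rule forward[of t n k "insert (n + 1, 1) ((\<lambda>m. (n - m, k)) ` {1..l})", OF t])
    let ?B = "(\<lambda>m. (n - m, k)) ` {1..l}"
    have serv: "?q (n + 1, 1) (n, k) = k * \<mu>"
      using n l k by (intro erlang_rate_service) (auto simp: erlang_defs)
    have "(\<Sum>x\<in>insert (n + 1, 1) ?B. ?q x (n, k) * P x t)
        = k * \<mu> * p (n + 1) 1 t + (\<Sum>x\<in>?B. ?q x (n, k) * P x t)"
      using t serv by (subst sum.insert) (auto simp: p_eq)
    also have "(\<Sum>x\<in>?B. ?q x (n, k) * P x t) = \<Lambda> * (\<Sum>m = 1..l. c m * p (n - m) k t)"
      using n by (intro sum_arrivals t) auto
    finally show "- (\<Lambda> + k * \<mu>) * p n k t + k * \<mu> * p (n + 1) 1 t + \<Lambda> * (\<Sum>m = 1..l. c m * p (n - m) k t)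
        = (\<Sum>x\<in>insert (n + 1, 1) ?B. ?q x (n, k) * P x t) - (\<Lambda> + (if (n, k) = (0, 0) then 0 else k * \<mu>)) * P (n, k) t"
      using t n by (simp add: p_eq algebra_simps)
    show "?q x (n, k) = 0" if "x \<in> erlang_states k" "x \<notin> insert (n + 1, 1) ?B" "x \<noteq> (n, k)" for x
    proof (rule erlang_rate_eq_0)
      show "\<not> erlang_service k x (n, k)" using that n by (auto simp: erlang_defs)
      fix m assume m: "m \<in> {1..l}"
      show "\<not> erlang_arrival k m x (n, k)"
      proof
        assume "erlang_arrival k m x (n, k)"
        hence "x = (n - m, k)" using n m by (auto simp: erlang_defs)
        thus False using that(2) m by auto
      qed
    qed
  qed (use n k in \<open>auto simp: erlang_defs\<close>)
  have "p 0 0 0 = 1" using P_init[of "(0, 0)"] by (simp add: p_eq)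
  moreover have "p n s 0 = 0" if "1 \<le> n" for n s using P_init[of "(n, s)"] that by (simp add: p_eq)
  ultimately show ?thesis using eq1 eq2 eq3 eq4 eq5 eq6 by auto
qed

end
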